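(* (1) The proof system $\mathcal{H}_{\mathsf{M}}$ is strongly sound and strongly complete for the class $\mathcal{M}$ of all measure-preserving dynamic Markov processes: for every set $\Gamma\cup\{\varphi\}$ of $\mathcal{L}_{\mathsf{DPL}}$-formulas, $\Gamma\vdash\varphi$ in $\mathcal{H}_{\mathsf{M}}$ if and only if $\Gamma\vDash_{\mathcal{M}}\varphi$. (2) The proof system $\mathcal{H}_{\mathsf{Pure}}$ is strongly sound and strongly complete for the class $\mathcal{P}ure$ of all purely probabilistic dynamic Markov processes: for every set $\Gamma\cup\{\varphi\}$ of $\mathcal{L}_{\mathsf{DPL}}$-formulas, $\Gamma\vdash\varphi$ in $\mathcal{H}_{\mathsf{Pure}}$ if and only if $\Gamma\vDash_{\mathcal{P}ure}\varphi$.
   Context: Language. $\mathbb{P}$ is a countable set of propositional variables. $\mathcal{L}_{\mathsf{DPL}}$-formulas: $\varphi ::= p\mid\neg\varphi\mid\varphi\wedge\varphi\mid L_r\varphi\mid\bigcirc\varphi$ with $p\in\mathbb{P}$, $r\in\mathbb{Q}\cap[0,1]$; other Boolean connectives are the usual abbreviations. $L_{r_1\dots r_k}\varphi$ abbreviates $L_{r_1}\cdots L_{r_k}\varphi$ (with $k\ge 0$). All indices $r,s,r_i$ range over $\mathbb{Q}\cap[0,1]$. Semantics. A dynamic Markov process is $\langle\Omega,\mathcal{A},T,f\rangle$ with $\langle\Omega,\mathcal{A}\rangle$ a measurable space ($\Omega\neq\emptyset$), $T:\Omega\times\mathcal{A}\to[0,1]$ a Markov kernel (each $T(w,\cdot)$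 is a $\sigma$-additive probability measure, each $T(\cdot,A)$ is measurable) and $f:\Omega\to\Omega$ measurable. It is measure-preserving if $T(w,f^{-1}(A))=T(f(w),A)$ for all $w\in\Omega$, $A\in\mathcal{A}$; it is purely probabilistic if $f=\mathrm{id}_\Omega$. A model $\mathfrak{M}$ based on it adds a valuation $v:\mathbb{P}\to\mathcal{A}$. Satisfaction: $\mathfrak{M},w\vDash p$ iff $w\in v(p)$; Boolean clauses as usual; $\mathfrak{M},w\vDash L_r\varphi$ iff $T(w,[\![\varphi]\!]_{\mathfrak{M}})\ge r$, where $[\![\varphi]\!]_{\mathfrak{M}}=\{w:\mathfrak{M},w\vDash\varphi\}$; $\mathfrak{M},w\vDash\bigcirc\varphi$ iff $\mathfrak{M},f(w)\vDash\varphi$. For a class $\mathcal{C}$ of processes, $\Gamma\vDash_{\mathcal{C}}\varphi$ means: for every model $\mathfrak{M}$ based on a member of $\mathcal{C}$ and every world $w$, if $\mathfrak{M},w\vDash\gamma$ for all $\gamma\in\Gamma$ then $\mathfrak{M},w\vDash\varphi$. Proof systems. Axiom schemes of $\mathcal{H}_{\mathsf{M}}$: all propositional tautologies; $L_0\bot$; $L_r\neg\varphi\to\neg L_s\varphi$ if $r+s>1$; $L_r(\varphi\wedge\psi)\wedge L_s(\varphi\wedge\neg\psi)\to L_{r+s}\varphi$ if $r+s\le1$; $\neg L_r(\varphi\wedge\psi)\wedge\neg L_s(\varphi\wedge\neg\psi)\to\neg L_{r+s}\varphi$ if $r+s\le1$; $L_1(\varphi\to\psi)\to(L_r\varphi\to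 L_r\psi)$; $\bigcirc\neg\varphi\leftrightarrow\neg\bigcirc\varphi$; $\bigcirc(\varphi\wedge\psi)\leftrightarrow(\bigcirc\varphi\wedge\bigcirc\psi)$; and (M) $L_r\bigcirc\varphi\leftrightarrow\bigcirc L_r\varphi$. Rules: modus ponens; $\mathrm{GArch}_r$: from $\{\psi\to L_{r_1\dots r_ks}\varphi\mid s<r\}$ infer $\psi\to L_{r_1\dots r_kr}\varphi$; $\mathrm{Nec}_{L_1}$: from $\varphi$ infer $L_1\varphi$; $\mathrm{Nec}_\bigcirc$: from $\varphi$ infer $\bigcirc\varphi$. $\mathcal{H}_{\mathsf{Pure}}$ is $\mathcal{H}_{\mathsf{M}}$ plus the axiom scheme $\bigcirc\varphi\leftrightarrow\varphi$. Derivability. A theorem ($\vdash\varphi$) is the last formula of a sequence of formulas indexed by the ordinals $\le\alpha+1$ (with $\alpha$ a countable ordinal) each member of which is an axiom or follows from (possibly infinitely many) earlier members by a rule. $\Gamma\vdash\varphi$ means there is such a sequence ending in $\varphi$ in which each member is in $\Gamma$, or is a theorem, or follows from earlier members by a rule other than $\mathrm{Nec}_{L_1}$ and $\mathrm{Nec}_\bigcirc$. *)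

theory Defs
  imports "HOL-Probability.Giry_Monad"
begin

section \<open>Language\<close>

typedef index = "{r::rat. 0 \<le> r \<and> r \<le> 1}"
  morphisms rat_of mk_index
  by (rule exI[of _ 0]) simp

datatype 'p fm =
    Var 'p
  | Neg "'p fm"
  | Conj "'p fm" "'p fm"
  | Lop index "'p fm"
  | Next "'p fm"

definition Imp :: "'p fm \<Rightarrow> 'p fm \<Rightarrow> 'p fm" where
  "Imp \<phi> \<psi> = Neg (Conj \<phi> (Neg \<psi>))"

definition Iff :: "'p fm \<Rightarrow> 'p fm \<Rightarrow> 'p fm" where
  "Iff \<phi> \<psi> = Conj (Imp \<phi> \<psi>) (Imp \<psi> \<phi>)"

text \<open>There is no primitive constant for falsum; it abbreviates a contradiction in some
  fixed propositional variable.\<close>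

definition Bot :: "'p fm" where
  "Bot = (let p = (SOME p. True) in Conj (Var p) (Neg (Var p)))"

definition Lops :: "index list \<Rightarrow> 'p fm \<Rightarrow> 'p fm" where
  "Lops rs \<phi> = foldr Lop rs \<phi>"


section \<open>Semantics\<close>

text \<open>The measurable space of a process is given by the space and the sets of
  \<open>events\<close>; the measure carried by \<open>events\<close> plays no role. The set of worlds is
  \<open>space events\<close>, which may be any nonempty subset of the type \<open>'w\<close>.\<close>

record 'w process =
  events :: "'w measure"
  kern :: "'w \<Rightarrow> 'w measure"
  dyn :: "'w \<Rightarrow> 'w"

text \<open>Measurability into \<open>prob_algebra\<close> is exactly the Markov kernel condition: every
  \<open>kern P w\<close> is a probability measure on the same \<open>\<sigma>\<close>-algebra, and evaluation at each
  event is a measurable function of \<open>w\<close>.\<close>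

definition dynamic_Markov_process :: "'w process \<Rightarrow> bool" where
  "dynamic_Markov_process P \<longleftrightarrow>
     space (events P) \<noteq> {} \<and>
     kern P \<in> events P \<rightarrow>\<^sub>M prob_algebra (events P) \<and>
     dyn P \<in> events P \<rightarrow>\<^sub>M events P"

definition measure_preserving :: "'w process \<Rightarrow> bool" where
  "measure_preserving P \<longleftrightarrow>
     (\<forall>w \<in> space (events P). \<forall>A \<in> sets (events P).
        measure (kern P w) (dyn P -` A \<inter> space (events P)) = measure (kern P (dyn P w)) A)"

definition purely_probabilistic :: "'w process \<Rightarrow> bool" where
  "purely_probabilistic P \<longleftrightarrow> (\<forall>w \<in> space (events P). dyn P w = w)"

definition MP_processes :: "'w itself \<Rightarrow> 'w process set" where
  "MP_processes _ = {P. dynamic_Markov_process P \<and> measure_preserving P}"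

definition Pure_processes :: "'w itself \<Rightarrow> 'w process set" where
  "Pure_processes _ = {P. dynamic_Markov_process P \<and> purely_probabilistic P}"

definition valuation :: "'w process \<Rightarrow> ('p \<Rightarrow> 'w set) \<Rightarrow> bool" where
  "valuation P v \<longleftrightarrow> (\<forall>p. v p \<in> sets (events P))"

primrec sat :: "'w process \<Rightarrow> ('p \<Rightarrow> 'w set) \<Rightarrow> 'w \<Rightarrow> 'p fm \<Rightarrow> bool" where
  "sat P v w (Var p) \<longleftrightarrow> w \<in> v p"
| "sat P v w (Neg \<phi>) \<longleftrightarrow> \<not> sat P v w \<phi>"
| "sat P v w (Conj \<phi> \<psi>) \<longleftrightarrow> sat P v w \<phi> \<and> sat P v w \<psi>"
| "sat P v w (Lop r \<phi>) \<longleftrightarrow>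
     measure (kern P w) {u \<in> space (events P). sat P v u \<phi>} \<ge> real_of_rat (rat_of r)"
| "sat P v w (Next \<phi>) \<longleftrightarrow> sat P v (dyn P w) \<phi>"

definition entails :: "'w process set \<Rightarrow> 'p fm set \<Rightarrow> 'p fm \<Rightarrow> bool" where
  "entails \<C> \<Gamma> \<phi> \<longleftrightarrow>
     (\<forall>P \<in> \<C>. \<forall>v. valuation P v \<longrightarrow>
        (\<forall>w \<in> space (events P). (\<forall>\<gamma> \<in> \<Gamma>. sat P v w \<gamma>) \<longrightarrow> sat P v w \<phi>))"


section \<open>Proof systems\<close>

text \<open>A tautology of the modal language is a substitution instance of a classical one:
  it holds under every Boolean assignment to the variables and to the formulas whose main
  operator is modal.\<close>

primrec bool_eval :: "('p fm \<Rightarrow> bool) \<Rightarrow> 'p fm \<Rightarrow> bool" where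
  "bool_eval h (Var p) \<longleftrightarrow> h (Var p)"
| "bool_eval h (Neg \<phi>) \<longleftrightarrow> \<not> bool_eval h \<phi>"
| "bool_eval h (Conj \<phi> \<psi>) \<longleftrightarrow> bool_eval h \<phi> \<and> bool_eval h \<psi>"
| "bool_eval h (Lop r \<phi>) \<longleftrightarrow> h (Lop r \<phi>)"
| "bool_eval h (Next \<phi>) \<longleftrightarrow> h (Next \<phi>)"

definition tautology :: "'p fm \<Rightarrow> bool" where
  "tautology \<phi> \<longleftrightarrow> (\<forall>h. bool_eval h \<phi>)"

inductive_set axioms_M :: "'p fm set" where
  Taut: "tautology \<phi> \<Longrightarrow> \<phi> \<in> axioms_M"
| L0: "Lop (mk_index 0) Bot \<in> axioms_M"
| LNeg: "rat_of r + rat_of s > 1 \<Longrightarrow> Imp (Lop r (Neg \<phi>)) (Neg (Lop s \<phi>)) \<in> axioms_M"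
| LAdd: "rat_of r + rat_of s \<le> 1 \<Longrightarrow>
     Imp (Conj (Lop r (Conj \<phi> \<psi>)) (Lop s (Conj \<phi> (Neg \<psi>))))
         (Lop (mk_index (rat_of r + rat_of s)) \<phi>) \<in> axioms_M"
| LSubadd: "rat_of r + rat_of s \<le> 1 \<Longrightarrow>
     Imp (Conj (Neg (Lop r (Conj \<phi> \<psi>))) (Neg (Lop s (Conj \<phi> (Neg \<psi>)))))
         (Neg (Lop (mk_index (rat_of r + rat_of s)) \<phi>)) \<in> axioms_M"
| LMono: "Imp (Lop (mk_index 1) (Imp \<phi> \<psi>)) (Imp (Lop r \<phi>) (Lop r \<psi>)) \<in> axioms_M"
| NextNeg: "Iff (Next (Neg \<phi>)) (Neg (Next \<phi>)) \<in> axioms_M"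
| NextConj: "Iff (Next (Conj \<phi> \<psi>)) (Conj (Next \<phi>) (Next \<psi>)) \<in> axioms_M"
| M: "Iff (Lop r (Next \<phi>)) (Next (Lop r \<phi>)) \<in> axioms_M"

definition axioms_Pure :: "'p fm set" where
  "axioms_Pure = axioms_M \<union> {Iff (Next \<phi>) \<phi> | \<phi>. True}"

text \<open>Rules relate a (possibly infinite) set of premises to a conclusion.\<close>

inductive basic_rule :: "'p fm set \<Rightarrow> 'p fm \<Rightarrow> bool" where
  MP: "basic_rule {\<phi>, Imp \<phi> \<psi>} \<psi>"
| GArch: "basic_rule {Imp \<psi> (Lops rs (Lop s \<phi>)) | s. rat_of s < rat_of r}
            (Imp \<psi> (Lops rs (Lop r \<phi>)))"

inductive nec_rule :: "'p fm set \<Rightarrow> 'p fm \<Rightarrow> bool" where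
  NecL1: "nec_rule {\<phi>} (Lop (mk_index 1) \<phi>)"
| NecNext: "nec_rule {\<phi>} (Next \<phi>)"

text \<open>The ordinals \<open>\<le> \<alpha> + 1\<close> with \<open>\<alpha>\<close> countable are represented, up to isomorphism, by a
  well-order \<open>r\<close> on a set of natural numbers with a greatest element \<open>m\<close> (the ordinal
  \<open>\<alpha> + 1\<close>) that is the immediate successor of an element \<open>a\<close> (the ordinal \<open>\<alpha>\<close>).\<close>

definition ordinals_upto_Suc :: "nat rel \<Rightarrow> nat \<Rightarrow> bool" where
  "ordinals_upto_Suc r m \<longleftrightarrow>
     Well_order r \<and> m \<in> Field r \<and>
     (\<exists>a \<in> Field r. a \<noteq> m \<and>
        (\<forall>i \<in> Field r. (i, m) \<in> r \<and> (i \<noteq> m \<longrightarrow> (i, a) \<in> r)))"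

definition derivation_seq ::
    "'p fm set \<Rightarrow> ('p fm set \<Rightarrow> 'p fm \<Rightarrow> bool) \<Rightarrow> nat rel \<Rightarrow> (nat \<Rightarrow> 'p fm) \<Rightarrow> bool" where
  "derivation_seq B R r \<sigma> \<longleftrightarrow>
     (\<forall>i \<in> Field r. \<sigma> i \<in> B \<or> (\<exists>X. X \<subseteq> \<sigma> ` underS r i \<and> R X (\<sigma> i)))"

definition is_theorem :: "'p fm set \<Rightarrow> 'p fm \<Rightarrow> bool" where
  "is_theorem Ax \<phi> \<longleftrightarrow>
     (\<exists>r m \<sigma>. ordinals_upto_Suc r m \<and>
        derivation_seq Ax (\<lambda>X \<psi>. basic_rule X \<psi> \<or> nec_rule X \<psi>) r \<sigma> \<and> \<sigma> m = \<phi>)"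

definition derives :: "'p fm set \<Rightarrow> 'p fm set \<Rightarrow> 'p fm \<Rightarrow> bool" where
  "derives Ax \<Gamma> \<phi> \<longleftrightarrow>
     (\<exists>r m \<sigma>. ordinals_upto_Suc r m \<and>
        derivation_seq (\<Gamma> \<union> {\<psi>. is_theorem Ax \<psi>}) basic_rule r \<sigma> \<and> \<sigma> m = \<phi>)"

text \<open>HOL cannot quantify over all types inside a formula, so semantic consequence is taken
  over the processes whose worlds form a subset of a given type. The next condition says that
  the type is large enough to contain an isomorphic copy of every process with at most
  continuum many worlds.\<close>

definition at_least_continuum :: "'w itself \<Rightarrow> bool" where
  "at_least_continuum _ \<longleftrightarrow> (\<exists>e :: nat set \<Rightarrow> 'w. inj e)"

end

theory Submission
  imports Defs
begin

text \<open>Soundness is an induction on derivations. Its only analytic step is the infinitary rule: the sets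
defined by \<open>Lops rs (Lop s \<phi>)\<close> decrease as \<open>s\<close> grows and, by continuity
from above of each \<open>kern P w\<close>, shrink to the set defined by \<open>Lops rs (Lop r \<phi>)\<close>
as \<open>s\<close> tends to \<open>r\<close> from below.

Completeness builds a canonical process for each logic containing the axioms. Its worlds are the
saturated sets: the complete sets of formulas that contain all theorems and obey the infinitary rule.
In a saturated set \<open>w\<close> the formulas \<open>Lop r \<phi>\<close> determine a number
\<open>mass w \<phi> = Sup {r. Lop r \<phi> \<in> w}\<close>, and the axioms make \<open>mass w\<close>
a finitely additive probability on formulas. The process exists once \<open>mass w\<close>, read as a
set function on the algebra of truth sets, is shown to be countably additive; the extension theorem of
Caratheodory then yields the kernel, axiom M says that the shift
\<open>u \<mapsto> {\<phi>. Next \<phi> \<in> u}\<close> preserves it, and a truth lemma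
finishes the argument.

Both places where saturated sets must be produced rest on one construction, the lemma
\<open>rasiowa_sikorski\<close>. The language is countable, so a saturated set arises in countably many
steps as long as a notion \<open>P\<close> of consistency survives each of them. With
\<open>P \<delta>\<close> read as ``\<open>Neg \<delta>\<close> is not derivable from
\<open>\<Gamma>\<close>'' this is the Lindenbaum lemma. With \<open>P \<delta>\<close> read as ``the masses of
\<open>Conj (\<theta> n) \<delta>\<close> are bounded away from 0'' it produces a world in the intersection
of every decreasing sequence of truth sets whose masses do not tend to 0, which is countable additivity.
In that second reading, the step for the infinitary rule works because the rule carries a prefix of
\<open>L\<close>-operators: prefixing one more operator to an instance of the rule says that the mass of
\<open>Lops rs (Lop s \<phi>)\<close> tends to the mass of \<open>Lops rs (Lop r \<phi>)\<close>, so that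
the failure of any single instance costs arbitrarily little mass.

Derivations are well-ordered sequences, but all reasoning is done with the inductively defined relation
\<open>derivable\<close>. The two agree because countably many well-ordered derivations can be concatenated
into one, and a rule has only countably many premises.\<close>

section \<open>Well-ordered derivations as an inductive closure\<close>

instance index :: countable
  by (intro countable_classI[of "\<lambda>r. to_nat (rat_of r)"]) (simp add: rat_of_inject)

instance fm :: (countable) countable
  by countable_datatype

inductive derivable :: "'p fm set \<Rightarrow> ('p fm set \<Rightarrow> 'p fm \<Rightarrow> bool) \<Rightarrow> 'p fm \<Rightarrow> bool" for B R where
  base: "\<phi> \<in> B \<Longrightarrow> derivable B R \<phi>"
| rule: "R X \<phi> \<Longrightarrow> (\<And>\<theta>. \<theta> \<in> X \<Longrightarrow> derivable B R \<theta>) \<Longrightarrow> derivable B R \<phi>"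

text \<open>Induction along the well-order of positions: the premises of a step occur strictly earlier.\<close>

lemma derivable_of_seq:
  assumes "Well_order r" "derivation_seq B R r \<sigma>" "i \<in> Field r"
  shows "derivable B R (\<sigma> i)"
proof -
  have "wf (r - Id)" using assms(1) by (simp add: well_order_on_def)
  then show ?thesis using assms(3)
  proof (induction i rule: wf_induct_rule)
    case (less i)
    from assms(2) less.prems consider "\<sigma> i \<in> B" | X where "X \<subseteq> \<sigma> ` underS r i" "R X (\<sigma> i)"
      unfolding derivation_seq_def by blast
    then show ?case
    proof cases
      case 2
      have "derivable B R \<theta>" if "\<theta> \<in> X" for \<theta>
        using that 2(1) less.IH by (auto simp: underS_def Field_def dest!: subsetD)
      with 2(2) show ?thesis by (rule derivable.rule)
    qed (rule derivable.base)
  qed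
qed

text \<open>The concatenation of the well-orders \<open>r 0, r 1, \<dots>\<close> on disjoint copies of their
fields; position \<open>i\<close> of block \<open>n\<close> is coded by \<open>prod_encode (n, i)\<close>.\<close>

definition lex_sum :: "(nat \<Rightarrow> nat rel) \<Rightarrow> nat rel" where
  "lex_sum r = {(x, y). case (prod_decode x, prod_decode y) of ((n, i), (n', i')) \<Rightarrow>
     i \<in> Field (r n) \<and> i' \<in> Field (r n') \<and> (n < n' \<or> n = n' \<and> (i, i') \<in> r n)}"

lemma lex_sum_iff:
  "(prod_encode (n, i), prod_encode (n', i')) \<in> lex_sum r \<longleftrightarrow>
     i \<in> Field (r n) \<and> i' \<in> Field (r n') \<and> (n < n' \<or> n = n' \<and> (i, i') \<in> r n)"
  by (simp add: lex_sum_def)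

lemma prod_encode_cases:
  obtains n i where "x = prod_encode (n, i)"
  by (metis prod.exhaust prod_decode_inverse)

lemma Field_lex_sum:
  assumes "\<And>n. Well_order (r n)"
  shows "Field (lex_sum r) = {prod_encode (n, i) | n i. i \<in> Field (r n)}"
proof (intro set_eqI iffI)
  fix x assume "x \<in> Field (lex_sum r)"
  then obtain y where y: "(x, y) \<in> lex_sum r \<or> (y, x) \<in> lex_sum r"
    by (auto simp: Field_def)
  obtain n i where x: "x = prod_encode (n, i)" by (rule prod_encode_cases)
  obtain n' i' where "y = prod_encode (n', i')" by (rule prod_encode_cases)
  with x y have "i \<in> Field (r n)" by (auto simp: lex_sum_iff)
  with x show "x \<in> {prod_encode (n, i) | n i. i \<in> Field (r n)}" by blast
next
  fix x assume "x \<in> {prod_encode (n, i) | n i. i \<in> Field (r n)}"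
  then obtain n i where x: "x = prod_encode (n, i)" "i \<in> Field (r n)" by blast
  then have "(i, i) \<in> r n"
    using assms[of n] by (simp add: order_on_defs refl_on_def)
  with x have "(x, x) \<in> lex_sum r" by (simp add: lex_sum_iff)
  then show "x \<in> Field (lex_sum r)" by (rule FieldI1)
qed

lemma Well_order_lex_sum:
  assumes wo: "\<And>n. Well_order (r n)"
  shows "Well_order (lex_sum r)"
proof -
  have refl: "(i, i) \<in> r n" if "i \<in> Field (r n)" for n i
    using wo[of n] that by (simp add: order_on_defs refl_on_def)
  have tr: "(i, k) \<in> r n" if "(i, j) \<in> r n" "(j, k) \<in> r n" for n i j k
    using wo[of n] that unfolding order_on_defs trans_def by blast
  have as: "i = j" if "(i, j) \<in> r n" "(j, i) \<in> r n" for n i j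
    using wo[of n] that unfolding order_on_defs antisym_def by blast
  have tot: "(i, j) \<in> r n \<or> (j, i) \<in> r n" if "i \<in> Field (r n)" "j \<in> Field (r n)" for n i j
    using wo[of n] that refl unfolding order_on_defs total_on_def by metis
  have wfr: "wf (r n - Id)" for n
    using wo[of n] by (simp add: well_order_on_def)
  note F = Field_lex_sum[of r, OF wo]
  have "refl_on (Field (lex_sum r)) (lex_sum r)"
    unfolding refl_on_def F by (auto simp: lex_sum_iff intro: refl)
  moreover have "trans (lex_sum r)"
  proof (rule transI)
    fix x y z assume *: "(x, y) \<in> lex_sum r" "(y, z) \<in> lex_sum r"
    obtain n i where x: "x = prod_encode (n, i)" by (rule prod_encode_cases)
    obtain n' i' where y: "y = prod_encode (n', i')" by (rule prod_encode_cases)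
    obtain n'' i'' where z: "z = prod_encode (n'', i'')" by (rule prod_encode_cases)
    from * show "(x, z) \<in> lex_sum r"
      unfolding x y z lex_sum_iff using tr by (metis less_trans)
  qed
  moreover have "antisym (lex_sum r)"
  proof (rule antisymI)
    fix x y assume *: "(x, y) \<in> lex_sum r" "(y, x) \<in> lex_sum r"
    obtain n i where x: "x = prod_encode (n, i)" by (rule prod_encode_cases)
    obtain n' i' where y: "y = prod_encode (n', i')" by (rule prod_encode_cases)
    from * show "x = y"
      unfolding x y lex_sum_iff using as by (metis less_asym)
  qed
  moreover have "total_on (Field (lex_sum r)) (lex_sum r)"
    unfolding total_on_def F using tot by (auto simp: lex_sum_iff) (metis linorder_neqE_nat)
  moreover have "wf (lex_sum r - Id)"
  proof (rule wfI_min)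
    fix x and Q :: "nat set"
    assume "x \<in> Q"
    show "\<exists>z\<in>Q. \<forall>y. (y, z) \<in> lex_sum r - Id \<longrightarrow> y \<notin> Q"
    proof (cases "Q \<inter> Field (lex_sum r) = {}")
      case True
      then show ?thesis using \<open>x \<in> Q\<close> by (auto simp: Field_def)
    next
      case False
      define N where "N = (LEAST n. \<exists>i \<in> Field (r n). prod_encode (n, i) \<in> Q)"
      have ex: "\<exists>n. \<exists>i \<in> Field (r n). prod_encode (n, i) \<in> Q"
        using False unfolding F by blast
      define A where "A = {i \<in> Field (r N). prod_encode (N, i) \<in> Q}"
      have "A \<noteq> {}"
        using LeastI_ex[OF ex] unfolding A_def N_def by blast
      then obtain i where i: "i \<in> A" "\<And>j. (j, i) \<in> r N - Id \<Longrightarrow> j \<notin> A"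
        using wfE_min[OF wfr[of N]] by (metis ex_in_conv)
      have "y \<notin> Q" if y: "(y, prod_encode (N, i)) \<in> lex_sum r - Id" for y
      proof
        assume "y \<in> Q"
        obtain n j where nj: "y = prod_encode (n, j)" by (rule prod_encode_cases)
        from y have *: "j \<in> Field (r n)" "n < N \<or> n = N \<and> (j, i) \<in> r N \<and> j \<noteq> i"
          by (auto simp: nj lex_sum_iff)
        have "\<not> n < N"
          using * \<open>y \<in> Q\<close> not_less_Least[of n "\<lambda>n. \<exists>i \<in> Field (r n). prod_encode (n, i) \<in> Q"]
          unfolding N_def nj by blast
        with * i(2)[of j] \<open>y \<in> Q\<close> show False by (auto simp: A_def nj)
      qed
      then show ?thesis using i(1) by (auto simp: A_def)
    qed
  qed
  moreover have "lex_sum r \<subseteq> Field (lex_sum r) \<times> Field (lex_sum r)"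
    by (auto simp: Field_def)
  ultimately show ?thesis by (simp add: order_on_defs)
qed

text \<open>A step of block \<open>n\<close> may use premises from its own block or anything from an earlier one.
The second possibility is what lets a rule be applied to the conclusions of all earlier blocks.\<close>

lemma derivation_seq_lex_sum:
  assumes wo: "\<And>n. Well_order (r n)"
    and seq: "\<And>n i. i \<in> Field (r n) \<Longrightarrow> \<sigma> n i \<in> B \<or>
      (\<exists>X. X \<subseteq> \<sigma> n ` underS (r n) i \<union> (\<Union>m<n. \<sigma> m ` Field (r m)) \<and> R X (\<sigma> n i))"
  shows "derivation_seq B R (lex_sum r) (\<lambda>x. case prod_decode x of (n, i) \<Rightarrow> \<sigma> n i)"
    (is "derivation_seq B R _ ?\<tau>")
  unfolding derivation_seq_def
proof
  fix x assume "x \<in> Field (lex_sum r)"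
  then obtain n i where x: "x = prod_encode (n, i)" "i \<in> Field (r n)"
    using Field_lex_sum[of r, OF wo] by auto
  have earlier: "\<sigma> n ` underS (r n) i \<union> (\<Union>m<n. \<sigma> m ` Field (r m)) \<subseteq> ?\<tau> ` underS (lex_sum r) x"
    (is "?L \<subseteq> _")
  proof
    fix \<theta> assume "\<theta> \<in> ?L"
    then obtain m j where mj: "\<theta> = \<sigma> m j" "j \<in> Field (r m)" "m < n \<or> m = n \<and> (j, i) \<in> r n \<and> j \<noteq> i"
      by (auto simp: underS_def Field_def)
    then have "prod_encode (m, j) \<in> underS (lex_sum r) x"
      using x by (auto simp: underS_def lex_sum_iff)
    moreover have "\<theta> = ?\<tau> (prod_encode (m, j))" using mj by simp
    ultimately show "\<theta> \<in> ?\<tau> ` underS (lex_sum r) x" by blast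
  qed
  show "?\<tau> x \<in> B \<or> (\<exists>X. X \<subseteq> ?\<tau> ` underS (lex_sum r) x \<and> R X (?\<tau> x))"
    using seq[OF x(2)]
  proof
    assume "\<exists>X. X \<subseteq> ?L \<and> R X (\<sigma> n i)"
    then obtain X where "X \<subseteq> ?L" "R X (\<sigma> n i)" by blast
    moreover from this(1) earlier have "X \<subseteq> ?\<tau> ` underS (lex_sum r) x" by (rule subset_trans)
    ultimately show ?thesis using x(1) by auto
  qed (simp add: x(1))
qed

text \<open>The derivations of the premises of a rule are concatenated in the order given by an enumeration of
formulas, and the conclusion is appended. It is appended twice because a derivation must end at the
immediate successor of another position.\<close>

lemma seq_of_derivable:
  fixes \<phi> :: "'p::countable fm"
  assumes "derivable B R \<phi>"
  shows "\<exists>r m \<sigma>. ordinals_upto_Suc r m \<and> derivation_seq B R r \<sigma> \<and> \<sigma> m = \<phi>"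
proof -
  have step: "\<exists>r m \<sigma>. ordinals_upto_Suc r m \<and> derivation_seq B R r \<sigma> \<and> \<sigma> m = \<phi>"
    if X: "\<And>\<theta>. \<theta> \<in> X \<Longrightarrow> \<exists>r m \<sigma>. ordinals_upto_Suc r m \<and> derivation_seq B R r \<sigma> \<and> \<sigma> m = \<theta>"
      and last: "\<phi> \<in> B \<or> R X \<phi>" for X and \<phi> :: "'p fm"
  proof -
    obtain q t \<tau> where q: "\<And>\<theta>. \<theta> \<in> X \<Longrightarrow>
        ordinals_upto_Suc (q \<theta>) (t \<theta>) \<and> derivation_seq B R (q \<theta>) (\<tau> \<theta>) \<and> \<tau> \<theta> (t \<theta>) = \<theta>"
      using X by metis
    define r where "r n = (let \<theta> = from_nat n in if \<theta> \<in> X then q \<theta> else {})" for n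
    define \<sigma> where "\<sigma> n = \<tau> (from_nat n)" for n
    have wo: "Well_order (r n)" for n
      using q by (auto simp: r_def Let_def ordinals_upto_Suc_def order_on_defs)
    \<comment> \<open>Block 0 holds the derivations of all premises; blocks 1 and 2 are single positions for the conclusion.\<close>
    define u where "u k = (if k = 0 then lex_sum r else if k \<le> 2 then {(0, 0)} else {})" for k :: nat
    define lab where "lab k = (if k = 0 then (\<lambda>x. case prod_decode x of (n, i) \<Rightarrow> \<sigma> n i) else (\<lambda>_. \<phi>))"
      for k :: nat
    have dr: "derivation_seq B R (r n) (\<sigma> n)" for n
      using q by (auto simp: r_def \<sigma>_def Let_def derivation_seq_def)
    have lab0: "lab 0 = (\<lambda>x. case prod_decode x of (n, i) \<Rightarrow> \<sigma> n i)"
      by (simp add: lab_def)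
    have d0: "derivation_seq B R (lex_sum r) (lab 0)"
      unfolding lab0
    proof (rule derivation_seq_lex_sum[OF wo])
      fix n i assume "i \<in> Field (r n)"
      with dr[of n] show "\<sigma> n i \<in> B \<or> (\<exists>Y. Y \<subseteq> \<sigma> n ` underS (r n) i \<union>
          (\<Union>m<n. \<sigma> m ` Field (r m)) \<and> R Y (\<sigma> n i))"
        unfolding derivation_seq_def by (meson le_supI1)
    qed
    have all: "X \<subseteq> lab 0 ` Field (u 0)"
    proof
      fix \<theta> assume \<theta>: "\<theta> \<in> X"
      then have "t \<theta> \<in> Field (r (to_nat \<theta>))"
        using q by (auto simp: r_def ordinals_upto_Suc_def)
      then have "prod_encode (to_nat \<theta>, t \<theta>) \<in> Field (u 0)"
        by (auto simp: u_def Field_lex_sum[of r, OF wo])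
      moreover have "lab 0 (prod_encode (to_nat \<theta>, t \<theta>)) = \<theta>"
        using q[OF \<theta>] by (simp add: lab_def \<sigma>_def)
      ultimately show "\<theta> \<in> lab 0 ` Field (u 0)" by force
    qed
    have sing: "Well_order {(0::nat, 0::nat)}"
      by (auto simp: order_on_defs refl_on_def trans_def antisym_def total_on_def Field_def)
    have wou: "Well_order (u k)" for k
      using Well_order_lex_sum[of r, OF wo] sing by (auto simp: u_def)
    have F12: "Field (u (Suc 0)) = {0}" "Field (u 2) = {0}"
      by (auto simp: u_def Field_def)
    have Fk: "Field (u k) = {}" if "k > 2" for k
      using that by (auto simp: u_def Field_def)
    note F = Field_lex_sum[of u, OF wou]
    have "derivation_seq B R (lex_sum u) (\<lambda>x. case prod_decode x of (n, i) \<Rightarrow> lab n i)"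
    proof (rule derivation_seq_lex_sum[OF wou])
      fix k i assume i: "i \<in> Field (u k)"
      show "lab k i \<in> B \<or> (\<exists>Y. Y \<subseteq> lab k ` underS (u k) i \<union> (\<Union>m<k. lab m ` Field (u m)) \<and> R Y (lab k i))"
      proof (cases "k = 0")
        case True
        then show ?thesis using d0 i by (auto simp: derivation_seq_def u_def)
      next
        case False
        then have "X \<subseteq> lab k ` underS (u k) i \<union> (\<Union>m<k. lab m ` Field (u m))"
          using all by auto
        then show ?thesis using last False by (auto simp: lab_def)
      qed
    qed
    moreover have "ordinals_upto_Suc (lex_sum u) (prod_encode (2, 0))"
      unfolding ordinals_upto_Suc_def
    proof (intro conjI bexI[of _ "prod_encode (1, 0)"] ballI)
      show "Well_order (lex_sum u)" by (rule Well_order_lex_sum[OF wou])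
      show "prod_encode (2, 0) \<in> Field (lex_sum u)" "prod_encode (1, 0) \<in> Field (lex_sum u)"
        unfolding F using F12 by simp_all
      show "prod_encode (1, 0) \<noteq> prod_encode (2, 0)" by simp
      fix x assume "x \<in> Field (lex_sum u)"
      then obtain k i where x: "x = prod_encode (k, i)" "i \<in> Field (u k)" using F by auto
      have "k \<le> 2" using Fk[of k] x(2) by (cases "k \<le> 2") auto
      then consider "k = 0" | "k = 1" "i = 0" | "k = 2" "i = 0"
        using x(2) F12 by (cases "k = 0"; cases "k = 1"; cases "k = 2") auto
      then have "(x, prod_encode (2, 0)) \<in> lex_sum u \<and>
          (x \<noteq> prod_encode (2, 0) \<longrightarrow> (x, prod_encode (1, 0)) \<in> lex_sum u)"
      proof cases
        case 1
        then show ?thesis using x F12 by (simp add: lex_sum_iff)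
      next
        case 2
        then show ?thesis using x F12 by (simp add: lex_sum_iff) (simp add: u_def)
      next
        case 3
        then show ?thesis using x F12 by (simp add: lex_sum_iff) (simp add: u_def)
      qed
      then show "(x, prod_encode (2, 0)) \<in> lex_sum u"
        and "x \<noteq> prod_encode (2, 0) \<longrightarrow> (x, prod_encode (1, 0)) \<in> lex_sum u"
        by simp_all
    qed
    moreover have "(case prod_decode (prod_encode (2, 0)) of (n, i) \<Rightarrow> lab n i) = \<phi>"
      by (simp add: lab_def)
    ultimately show ?thesis by blast
  qed
  from assms show ?thesis
  proof induction
    case (base \<phi>)
    show ?case by (rule step[of "{}"]) (use base in simp_all)
  next
    case (rule X \<phi>)
    show ?case by (rule step[of X]) (use rule in simp_all)
  qed
qed

lemma derivable_iff_seq: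
  fixes \<phi> :: "'p::countable fm"
  shows "derivable B R \<phi> \<longleftrightarrow>
    (\<exists>r m \<sigma>. ordinals_upto_Suc r m \<and> derivation_seq B R r \<sigma> \<and> \<sigma> m = \<phi>)"
proof
  assume "\<exists>r m \<sigma>. ordinals_upto_Suc r m \<and> derivation_seq B R r \<sigma> \<and> \<sigma> m = \<phi>"
  then obtain r m \<sigma> where "ordinals_upto_Suc r m" "derivation_seq B R r \<sigma>" "\<sigma> m = \<phi>"
    by blast
  then show "derivable B R \<phi>"
    using derivable_of_seq[of r B R \<sigma> m] by (simp add: ordinals_upto_Suc_def)
qed (rule seq_of_derivable)

lemma is_theorem_iff_derivable:
  "is_theorem Ax (\<phi> :: 'p::countable fm) \<longleftrightarrow> derivable Ax (\<lambda>X \<psi>. basic_rule X \<psi> \<or> nec_rule X \<psi>) \<phi>"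
  by (simp add: is_theorem_def derivable_iff_seq)

lemma derives_iff_derivable:
  "derives Ax \<Gamma> (\<phi> :: 'p::countable fm) \<longleftrightarrow> derivable (\<Gamma> \<union> {\<psi>. is_theorem Ax \<psi>}) basic_rule \<phi>"
  by (simp add: derives_def derivable_iff_seq)

section \<open>Soundness\<close>

abbreviation val :: "index \<Rightarrow> real" where
  "val r \<equiv> real_of_rat (rat_of r)"

lemma rat_of_bounds: "0 \<le> rat_of r" "rat_of r \<le> 1"
  using rat_of[of r] by auto

lemma val_bounds: "0 \<le> val r" "val r \<le> 1"
  using rat_of_bounds[of r] by (simp_all add: of_rat_le_1_iff)

lemma rat_of_mk_index [simp]: "0 \<le> q \<Longrightarrow> q \<le> 1 \<Longrightarrow> rat_of (mk_index q) = q"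
  by (simp add: mk_index_inverse)

lemma val_mk_index_0_1 [simp]: "val (mk_index 0) = 0" "val (mk_index 1) = 1"
  by simp_all

text \<open>Density of the indices, in the form used to compare real measures with the operators \<open>Lop r\<close>.\<close>

lemma ex_index_between:
  assumes "a < b" "0 \<le> a" "a < 1"
  obtains r where "a < val r" "val r < b"
proof -
  obtain q where q: "a < real_of_rat q" "real_of_rat q < min b 1"
    using of_rat_dense[of a "min b 1"] assms by (metis min_less_iff_conj)
  then have "0 \<le> real_of_rat q" "real_of_rat q \<le> 1" using assms by linarith+
  then have "0 \<le> q" "q \<le> 1"
    by (simp_all add: zero_le_of_rat_iff of_rat_le_1_iff)
  with q that[of "mk_index q"] show thesis by simp
qed

lemma Lops_simps [simp]: "Lops [] \<phi> = \<phi>" "Lops (r # rs) \<phi> = Lop r (Lops rs \<phi>)"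
  by (simp_all add: Lops_def)

abbreviation extension :: "'w process \<Rightarrow> ('p \<Rightarrow> 'w set) \<Rightarrow> 'p fm \<Rightarrow> 'w set" where
  "extension P v \<phi> \<equiv> {u \<in> space (events P). sat P v u \<phi>}"

locale model =
  fixes P :: "'w process" and v :: "'p::countable \<Rightarrow> 'w set"
  assumes process: "dynamic_Markov_process P" and valuation: "valuation P v"
begin

lemma kern_measurable [measurable]: "kern P \<in> events P \<rightarrow>\<^sub>M prob_algebra (events P)"
  and dyn_measurable [measurable]: "dyn P \<in> events P \<rightarrow>\<^sub>M events P"
  using process by (auto simp: dynamic_Markov_process_def)

lemma dyn_in_space: "w \<in> space (events P) \<Longrightarrow> dyn P w \<in> space (events P)"
  using dyn_measurable by (rule measurable_space)

lemma kern_prob: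
  assumes "w \<in> space (events P)"
  shows "prob_space (kern P w)" "sets (kern P w) = sets (events P)"
    "space (kern P w) = space (events P)"
  using measurable_space[OF kern_measurable assms]
  by (auto simp: space_prob_algebra dest: sets_eq_imp_space_eq)

lemma extension_in_sets: "extension P v \<phi> \<in> sets (events P)"
proof (induction \<phi>)
  case (Var p)
  then show ?case using valuation by (simp add: valuation_def)
next
  case (Neg \<phi>)
  have "extension P v (Neg \<phi>) = space (events P) - extension P v \<phi>" by auto
  with Neg show ?case by auto
next
  case (Conj \<phi> \<psi>)
  have "extension P v (Conj \<phi> \<psi>) = extension P v \<phi> \<inter> extension P v \<psi>" by auto
  with Conj show ?case by auto
next
  case (Lop r \<phi>)
  have "(\<lambda>w. measure (kern P w) (extension P v \<phi>)) \<in> borel_measurable (events P)"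
    using measurable_compose[OF kern_measurable measurable_measure_prob_algebra[OF Lop]] .
  then show ?case by simp
next
  case (Next \<phi>)
  have "extension P v (Next \<phi>) = dyn P -` extension P v \<phi> \<inter> space (events P)"
    using dyn_in_space by auto
  with Next show ?case by (simp only: measurable_sets[OF dyn_measurable])
qed

definition valid :: "'p fm \<Rightarrow> bool" where
  "valid \<phi> \<longleftrightarrow> (\<forall>w \<in> space (events P). sat P v w \<phi>)"

lemma sat_Imp [simp]: "sat P v w (Imp \<phi> \<psi>) \<longleftrightarrow> (sat P v w \<phi> \<longrightarrow> sat P v w \<psi>)"
  by (simp add: Imp_def)

lemma sat_Iff [simp]: "sat P v w (Iff \<phi> \<psi>) \<longleftrightarrow> (sat P v w \<phi> \<longleftrightarrow> sat P v w \<psi>)"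
  by (auto simp: Iff_def)

lemma sat_bool_eval: "bool_eval (sat P v w) \<phi> \<longleftrightarrow> sat P v w \<phi>"
  by (induction \<phi>) auto

lemma measure_split:
  assumes "w \<in> space (events P)"
  shows "measure (kern P w) (extension P v \<phi>) =
    measure (kern P w) (extension P v (Conj \<phi> \<psi>)) + measure (kern P w) (extension P v (Conj \<phi> (Neg \<psi>)))"
proof -
  interpret K: prob_space "kern P w" using assms by (rule kern_prob)
  have "extension P v \<phi> = extension P v (Conj \<phi> \<psi>) \<union> extension P v (Conj \<phi> (Neg \<psi>))" by auto
  then show ?thesis
    using extension_in_sets kern_prob[OF assms] by (simp only:) (intro K.finite_measure_Union, auto)
qed

lemma axioms_M_valid:
  assumes MP: "measure_preserving P" and "\<phi> \<in> axioms_M"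
  shows "valid \<phi>"
  unfolding valid_def
proof
  fix w assume w: "w \<in> space (events P)"
  interpret K: prob_space "kern P w" using w by (rule kern_prob)
  have E: "extension P v \<psi> \<in> sets (kern P w)" for \<psi> using extension_in_sets kern_prob[OF w] by simp
  have sp: "space (kern P w) = space (events P)" using kern_prob[OF w] by simp
  have neg: "K.prob (extension P v (Neg \<psi>)) = 1 - K.prob (extension P v \<psi>)" for \<psi>
  proof -
    have "extension P v (Neg \<psi>) = space (kern P w) - extension P v \<psi>" by (auto simp: sp)
    then show ?thesis using K.prob_compl[OF E] by simp
  qed
  have tf: "val r + val s = real_of_rat (rat_of r + rat_of s)" for r s
    by (simp add: of_rat_add)
  from assms(2) show "sat P v w \<phi>"
  proof cases
    case Taut
    then show ?thesis using sat_bool_eval by (auto simp: tautology_def)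
  next
    case (LNeg r s \<psi>)
    have "1 < val r + val s" using LNeg unfolding tf by (simp add: one_less_of_rat_iff)
    then show ?thesis using neg[of \<psi>] LNeg(1) by auto
  next
    case (LAdd r s \<psi> \<theta>)
    have "0 \<le> rat_of r + rat_of s" using rat_of_bounds by simp
    then show ?thesis using LAdd measure_split[OF w, of \<psi> \<theta>] by (auto simp: of_rat_add)
  next
    case (LSubadd r s \<psi> \<theta>)
    have "0 \<le> rat_of r + rat_of s" using rat_of_bounds by simp
    then show ?thesis using LSubadd measure_split[OF w, of \<psi> \<theta>] by (auto simp: of_rat_add)
  next
    case (LMono \<psi> \<theta> r)
    have "K.prob (extension P v \<psi>) \<le> K.prob (extension P v \<theta>)" if "K.prob (extension P v (Imp \<psi> \<theta>)) \<ge> 1"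
    proof -
      have "K.prob (extension P v (Imp \<psi> \<theta>)) = 1" using that K.prob_le_1 by (simp add: antisym)
      moreover have "extension P v (Imp \<psi> \<theta>) = space (kern P w) - extension P v (Conj \<psi> (Neg \<theta>))"
        by (auto simp: sp)
      ultimately have "K.prob (extension P v (Conj \<psi> (Neg \<theta>))) = 0"
        using K.prob_compl[OF E[of "Conj \<psi> (Neg \<theta>)"]] by simp
      then have "K.prob (extension P v \<psi>) = K.prob (extension P v (Conj \<psi> \<theta>))"
        using measure_split[OF w, of \<psi> \<theta>] by simp
      also have "\<dots> \<le> K.prob (extension P v \<theta>)" by (intro K.finite_measure_mono E) auto
      finally show ?thesis .
    qed
    then show ?thesis using LMono by fastforce
  next
    case (M r \<psi>)
    have "extension P v (Next \<psi>) = dyn P -` extension P v \<psi> \<inter> space (events P)"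
      using dyn_in_space by auto
    then have "K.prob (extension P v (Next \<psi>)) = measure (kern P (dyn P w)) (extension P v \<psi>)"
      using MP w extension_in_sets[of \<psi>] by (simp only: measure_preserving_def)
    then show ?thesis using M by simp
  qed auto
qed

lemma sat_Lops_antimono:
  assumes "rat_of s \<le> rat_of r" "w \<in> space (events P)" "sat P v w (Lops rs (Lop r \<phi>))"
  shows "sat P v w (Lops rs (Lop s \<phi>))"
  using assms(2,3)
proof (induction rs arbitrary: w)
  case Nil
  have "val s \<le> val r" using assms(1) by (simp add: of_rat_less_eq)
  with Nil show ?case by simp
next
  case (Cons t rs)
  interpret K: prob_space "kern P w" using Cons.prems(1) by (rule kern_prob)
  have "K.prob (extension P v (Lops rs (Lop r \<phi>))) \<le> K.prob (extension P v (Lops rs (Lop s \<phi>)))"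
    using Cons.IH extension_in_sets kern_prob(2)[OF Cons.prems(1)]
    by (intro K.finite_measure_mono) auto
  with Cons.prems show ?case by simp
qed

lemma sat_Lops_0:
  assumes "rat_of r = 0" "w \<in> space (events P)"
  shows "sat P v w (Lops rs (Lop r \<phi>))"
  using assms(2)
proof (induction rs arbitrary: w)
  case (Cons t rs)
  interpret K: prob_space "kern P w" using Cons.prems by (rule kern_prob)
  have "extension P v (Lops rs (Lop r \<phi>)) = space (kern P w)"
    using Cons.IH kern_prob(3)[OF Cons.prems] by auto
  then show ?case using val_bounds[of t] K.prob_space by simp
qed (simp add: assms(1))

text \<open>A sequence of indices increasing to \<open>r\<close> replaces the set of all \<open>s < r\<close>, so
continuity from above applies at each operator of the prefix \<open>rs\<close>. The index 0 has no smaller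
ones and is covered by \<open>sat_Lops_0\<close>: \<open>Lop r\<close> then holds everywhere.\<close>

lemma GArch_sound:
  assumes "w \<in> space (events P)"
    and "\<And>s. rat_of s < rat_of r \<Longrightarrow> sat P v w (Lops rs (Lop s \<phi>))"
  shows "sat P v w (Lops rs (Lop r \<phi>))"
proof (cases "rat_of r = 0")
  case False
  with rat_of_bounds[of r] have r: "0 < rat_of r" by simp
  \<comment> \<open>A sequence of rationals increasing to the value of \<open>r\<close> and staying below it.\<close>
  define q :: "nat \<Rightarrow> rat" where "q n = rat_of r * (1 - 1 / of_nat (Suc n))" for n
  define s where "s n = mk_index (q n)" for n
  have q: "0 \<le> q n" "q n < rat_of r" for n
    using r by (auto simp: q_def field_simps)
  then have s: "rat_of (s n) = q n" for n
    using rat_of_bounds[of r] unfolding s_def by (intro rat_of_mk_index) (meson less_imp_le order.trans)+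
  have mono: "rat_of (s m) \<le> rat_of (s n)" if "m \<le> n" for m n
    using that r unfolding s q_def by (intro mult_left_mono diff_left_mono divide_left_mono) auto
  have "(\<lambda>n. val r * (1 - 1 / real (Suc n))) \<longlonglongrightarrow> val r * (1 - 0)"
    using LIMSEQ_inverse_real_of_nat by (intro tendsto_intros) (simp add: inverse_eq_divide)
  then have lim: "(\<lambda>n. val (s n)) \<longlonglongrightarrow> val r"
    by (simp add: s q_def of_rat_mult of_rat_diff of_rat_divide of_rat_add)
  have "sat P v w (Lops rs (Lop r \<phi>))"
    if "w \<in> space (events P)" "\<And>n. sat P v w (Lops rs (Lop (s n) \<phi>))" for w
    using that
  proof (induction rs arbitrary: w)
    case Nil
    then have "val (s n) \<le> measure (kern P w) (extension P v \<phi>)" for n by simp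
    with lim show ?case by (auto intro: LIMSEQ_le_const2)
  next
    case (Cons t rs)
    interpret K: prob_space "kern P w" using Cons.prems(1) by (rule kern_prob)
    let ?A = "\<lambda>n. extension P v (Lops rs (Lop (s n) \<phi>))"
    have "range ?A \<subseteq> sets (kern P w)"
      using extension_in_sets kern_prob(2)[OF Cons.prems(1)] by auto
    moreover have "decseq ?A"
      using sat_Lops_antimono mono unfolding decseq_def by blast
    ultimately have "(\<lambda>n. K.prob (?A n)) \<longlonglongrightarrow> K.prob (\<Inter>n. ?A n)"
      by (rule K.finite_Lim_measure_decseq)
    moreover have "val t \<le> K.prob (?A n)" for n using Cons.prems(2)[of n] by simp
    ultimately have "val t \<le> K.prob (\<Inter>n. ?A n)" by (auto intro: LIMSEQ_le_const)
    also have "(\<Inter>n. ?A n) = extension P v (Lops rs (Lop r \<phi>))"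
    proof (intro set_eqI iffI)
      fix u assume "u \<in> (\<Inter>n. ?A n)"
      then show "u \<in> extension P v (Lops rs (Lop r \<phi>))" using Cons.IH[of u] by simp
    next
      fix u assume "u \<in> extension P v (Lops rs (Lop r \<phi>))"
      moreover have "rat_of (s n) \<le> rat_of r" for n using q(2)[of n] by (simp add: s)
      ultimately show "u \<in> (\<Inter>n. ?A n)" using sat_Lops_antimono by blast
    qed
    finally show ?case by simp
  qed
  with assms q(2) s show ?thesis by simp
qed (rule sat_Lops_0[OF _ assms(1)])

lemma basic_rule_sound:
  assumes "basic_rule X \<phi>" "w \<in> space (events P)" "\<And>\<theta>. \<theta> \<in> X \<Longrightarrow> sat P v w \<theta>"
  shows "sat P v w \<phi>"
  using assms(1)
proof cases
  case (MP \<psi>)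
  then show ?thesis using assms(3)[of \<psi>] assms(3)[of "Imp \<psi> \<phi>"] by simp
next
  case (GArch \<psi> rs \<theta> r)
  have "sat P v w (Imp \<psi> (Lops rs (Lop s \<theta>)))" if "rat_of s < rat_of r" for s
    using assms(3) that GArch(1) by blast
  then show ?thesis using GArch_sound[OF assms(2), of r rs \<theta>] GArch(2) by simp
qed

lemma nec_rule_valid:
  assumes "nec_rule X \<phi>" "\<And>\<theta>. \<theta> \<in> X \<Longrightarrow> valid \<theta>"
  shows "valid \<phi>"
  using assms(1)
proof cases
  case (NecL1 \<psi>)
  have "measure (kern P w) (extension P v \<psi>) = 1" if w: "w \<in> space (events P)" for w
  proof -
    interpret K: prob_space "kern P w" using w by (rule kern_prob)
    have "extension P v \<psi> = space (kern P w)"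
      using assms(2)[of \<psi>] NecL1 kern_prob(3)[OF w] by (auto simp: valid_def)
    then show ?thesis using K.prob_space by simp
  qed
  with NecL1 show ?thesis by (simp add: valid_def)
next
  case (NecNext \<psi>)
  then show ?thesis using assms(2) dyn_in_space by (simp add: valid_def)
qed

lemma theorem_valid:
  assumes "\<And>\<theta>. \<theta> \<in> Ax \<Longrightarrow> valid \<theta>" "is_theorem Ax \<phi>"
  shows "valid \<phi>"
  using assms(2) unfolding is_theorem_iff_derivable
proof induction
  case (rule X \<phi>)
  from rule.hyps consider "basic_rule X \<phi>" | "nec_rule X \<phi>" by blast
  then show ?case
  proof cases
    case 1
    then show ?thesis using rule.IH basic_rule_sound[of X \<phi>] by (simp add: valid_def)
  next
    case 2
    then show ?thesis using rule.IH by (rule nec_rule_valid)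
  qed
qed (rule assms(1))

lemma derives_sound:
  assumes "\<And>\<theta>. \<theta> \<in> Ax \<Longrightarrow> valid \<theta>" "derives Ax \<Gamma> \<phi>"
    and "w \<in> space (events P)" "\<And>\<gamma>. \<gamma> \<in> \<Gamma> \<Longrightarrow> sat P v w \<gamma>"
  shows "sat P v w \<phi>"
  using assms(2) unfolding derives_iff_derivable
proof induction
  case (base \<phi>)
  then show ?case using theorem_valid[of Ax \<phi>] assms(1,3,4) by (auto simp: valid_def)
next
  case (rule X \<phi>)
  then show ?case using basic_rule_sound assms(3) by blast
qed

end

lemma pure_imp_measure_preserving:
  assumes "dynamic_Markov_process P" "purely_probabilistic P"
  shows "measure_preserving P"
  unfolding measure_preserving_def
proof (intro ballI)
  fix w A assume w: "w \<in> space (events P)" and A: "A \<in> sets (events P)"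
  then have "dyn P -` A \<inter> space (events P) = A"
    using assms(2) sets.sets_into_space[OF A] by (auto simp: purely_probabilistic_def)
  then show "measure (kern P w) (dyn P -` A \<inter> space (events P)) = measure (kern P (dyn P w)) A"
    using assms(2) w by (simp add: purely_probabilistic_def)
qed

lemma soundness_M:
  fixes \<phi> :: "'p::countable fm"
  assumes "derives axioms_M \<Gamma> \<phi>"
  shows "entails (MP_processes TYPE('w)) \<Gamma> \<phi>"
  unfolding entails_def
proof (intro ballI allI impI)
  fix P :: "'w process" and v :: "'p \<Rightarrow> 'w set" and w
  assume *: "P \<in> MP_processes TYPE('w)" "valuation P v" "w \<in> space (events P)"
    "\<forall>\<gamma> \<in> \<Gamma>. sat P v w \<gamma>"
  then interpret model P v by unfold_locales (auto simp: MP_processes_def)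
  from * show "sat P v w \<phi>"
    by (intro derives_sound[OF _ assms]) (auto simp: MP_processes_def intro: axioms_M_valid)
qed

lemma soundness_Pure:
  fixes \<phi> :: "'p::countable fm"
  assumes "derives axioms_Pure \<Gamma> \<phi>"
  shows "entails (Pure_processes TYPE('w)) \<Gamma> \<phi>"
  unfolding entails_def
proof (intro ballI allI impI)
  fix P :: "'w process" and v :: "'p \<Rightarrow> 'w set" and w
  assume *: "P \<in> Pure_processes TYPE('w)" "valuation P v" "w \<in> space (events P)"
    "\<forall>\<gamma> \<in> \<Gamma>. sat P v w \<gamma>"
  then interpret model P v by unfold_locales (auto simp: Pure_processes_def)
  from * have pure: "purely_probabilistic P" by (simp add: Pure_processes_def)
  have "valid \<theta>" if "\<theta> \<in> axioms_Pure" for \<theta>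
    using that pure axioms_M_valid[OF pure_imp_measure_preserving[OF process pure]]
    by (auto simp: axioms_Pure_def valid_def purely_probabilistic_def)
  with * show "sat P v w \<phi>"
    by (intro derives_sound[OF _ assms]) auto
qed

section \<open>Logics containing the axioms\<close>

lemma bool_eval_Imp [simp]: "bool_eval h (Imp \<phi> \<psi>) \<longleftrightarrow> (bool_eval h \<phi> \<longrightarrow> bool_eval h \<psi>)"
  by (simp add: Imp_def)

lemma bool_eval_Bot [simp]: "\<not> bool_eval h Bot"
  by (simp add: Bot_def Let_def)

text \<open>The common treatment of both proof systems: any set of formulas containing the axioms and closed under
the rules. The canonical process is built for every such set of theorems.\<close>

locale dpl_logic =
  fixes Th :: "'p::countable fm set"
  assumes axioms_M_in: "axioms_M \<subseteq> Th"
    and basic_rule_closed: "basic_rule X \<phi> \<Longrightarrow> X \<subseteq> Th \<Longrightarrow> \<phi> \<in> Th"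
    and nec_rule_closed: "nec_rule X \<phi> \<Longrightarrow> X \<subseteq> Th \<Longrightarrow> \<phi> \<in> Th"
begin

definition deductively_closed :: "'p fm set \<Rightarrow> bool" where
  "deductively_closed D \<longleftrightarrow> Th \<subseteq> D \<and> (\<forall>X \<phi>. basic_rule X \<phi> \<longrightarrow> X \<subseteq> D \<longrightarrow> \<phi> \<in> D)"

lemma deductively_closed_Th: "deductively_closed Th"
  using basic_rule_closed by (auto simp: deductively_closed_def)

lemma closed_mp:
  assumes "deductively_closed D" "\<phi> \<in> D" "Imp \<phi> \<psi> \<in> D"
  shows "\<psi> \<in> D"
  using assms basic_rule.MP[of \<phi> \<psi>] unfolding deductively_closed_def by blast

lemma closed_taut:
  assumes "deductively_closed D" "tautology \<phi>"
  shows "\<phi> \<in> D"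
  using assms axioms_M_in axioms_M.Taut[of \<phi>] unfolding deductively_closed_def by blast

lemma closed_consequence:
  assumes "deductively_closed D" "\<phi> \<in> D" "\<And>h. bool_eval h \<phi> \<Longrightarrow> bool_eval h \<psi>"
  shows "\<psi> \<in> D"
  by (rule closed_mp[OF assms(1,2)], rule closed_taut[OF assms(1)])
    (simp add: tautology_def assms(3))

lemma closed_consequence2:
  assumes "deductively_closed D" "\<phi> \<in> D" "\<psi> \<in> D"
    "\<And>h. bool_eval h \<phi> \<Longrightarrow> bool_eval h \<psi> \<Longrightarrow> bool_eval h \<theta>"
  shows "\<theta> \<in> D"
proof -
  have "Imp \<psi> \<theta> \<in> D" using assms(1,2) by (rule closed_consequence) (use assms(4) in simp)
  with assms(1,3) show ?thesis by (rule closed_mp)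
qed

lemmas Th_mp = closed_mp[OF deductively_closed_Th]
lemmas Th_taut = closed_taut[OF deductively_closed_Th]
lemmas Th_consequence = closed_consequence[OF deductively_closed_Th]
lemmas Th_consequence2 = closed_consequence2[OF deductively_closed_Th]

lemma Th_taut_Imp: "(\<And>h. bool_eval h \<phi> \<Longrightarrow> bool_eval h \<psi>) \<Longrightarrow> Imp \<phi> \<psi> \<in> Th"
  by (rule Th_taut) (simp add: tautology_def)

lemma closed_GArch:
  assumes "deductively_closed D" "\<And>s. rat_of s < rat_of r \<Longrightarrow> Imp \<psi> (Lops rs (Lop s \<phi>)) \<in> D"
  shows "Imp \<psi> (Lops rs (Lop r \<phi>)) \<in> D"
  using assms basic_rule.GArch[of \<psi> rs \<phi> r] unfolding deductively_closed_def by blast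

text \<open>The rule without its antecedent \<open>\<psi>\<close>, obtained by taking \<open>\<psi>\<close> to be a
tautology.\<close>

lemma closed_GArch':
  assumes "deductively_closed D" "\<And>s. rat_of s < rat_of r \<Longrightarrow> Lops rs (Lop s \<phi>) \<in> D"
  shows "Lops rs (Lop r \<phi>) \<in> D"
proof -
  have "Imp (Neg Bot) (Lops rs (Lop s \<phi>)) \<in> D" if "rat_of s < rat_of r" for s
    using assms(1) assms(2)[OF that] by (rule closed_consequence) simp
  then have "Imp (Neg Bot) (Lops rs (Lop r \<phi>)) \<in> D" by (rule closed_GArch[OF assms(1)])
  with assms(1) show ?thesis by (rule closed_consequence) simp
qed

lemma Th_Lop_1: "\<phi> \<in> Th \<Longrightarrow> Lop (mk_index 1) \<phi> \<in> Th"
  using nec_rule_closed[OF nec_rule.NecL1] by blast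

lemma Th_Next: "\<phi> \<in> Th \<Longrightarrow> Next \<phi> \<in> Th"
  using nec_rule_closed[OF nec_rule.NecNext] by blast

lemma Th_Lop_mono: "Imp \<phi> \<psi> \<in> Th \<Longrightarrow> Imp (Lop r \<phi>) (Lop r \<psi>) \<in> Th"
  using Th_mp[OF Th_Lop_1] axioms_M.LMono[of \<phi> \<psi> r] axioms_M_in by blast

lemma Th_Lops_mono: "Imp \<phi> \<psi> \<in> Th \<Longrightarrow> Imp (Lops rs \<phi>) (Lops rs \<psi>) \<in> Th"
  by (induction rs) (simp_all add: Th_Lop_mono)

lemma Th_Lops_0: "rat_of r = 0 \<Longrightarrow> Lops rs (Lop r \<phi>) \<in> Th"
  by (rule closed_GArch'[OF deductively_closed_Th]) (metis rat_of_bounds(1) not_less)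

lemma Th_not_Lop_Bot:
  assumes "0 < rat_of r"
  shows "Neg (Lop r Bot) \<in> Th"
proof -
  have "Lop (mk_index 1) (Neg Bot) \<in> Th" by (intro Th_Lop_1 Th_taut) (simp add: tautology_def)
  moreover have "Imp (Lop (mk_index 1) (Neg Bot)) (Neg (Lop r Bot)) \<in> Th"
    using axioms_M.LNeg[of "mk_index 1" r Bot] assms axioms_M_in by auto
  ultimately show ?thesis by (rule Th_mp)
qed

text \<open>With \<open>t = r - s\<close>, the subadditivity axiom for \<open>\<phi>\<close> split by itself says that
failure of \<open>Lop s \<phi>\<close> and of \<open>Lop t\<close> of a contradiction entails failure of
\<open>Lop r \<phi>\<close>; and \<open>Lop t\<close> of a contradiction is refutable for positive
\<open>t\<close>.\<close>

lemma Th_Lop_antimono: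
  assumes "rat_of s \<le> rat_of r"
  shows "Imp (Lop r \<phi>) (Lop s \<phi>) \<in> Th"
proof (cases "s = r")
  case True
  then show ?thesis by (intro Th_taut) (simp add: tautology_def)
next
  case False
  with assms have sr: "rat_of s < rat_of r" by (simp add: less_le rat_of_inject)
  define t where "t = mk_index (rat_of r - rat_of s)"
  have t: "rat_of t = rat_of r - rat_of s"
    using sr rat_of_bounds[of r] rat_of_bounds[of s] by (simp add: t_def)
  have "rat_of s + rat_of t \<le> 1" using t rat_of_bounds by simp
  moreover have "mk_index (rat_of s + rat_of t) = r" by (simp add: t rat_of_inverse)
  ultimately have sub: "Imp (Conj (Neg (Lop s (Conj \<phi> \<phi>))) (Neg (Lop t (Conj \<phi> (Neg \<phi>))))) (Neg (Lop r \<phi>)) \<in> Th"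
    using axioms_M.LSubadd[of s t \<phi> \<phi>] axioms_M_in by auto
  have "Imp (Lop t (Conj \<phi> (Neg \<phi>))) (Lop t Bot) \<in> Th"
    by (intro Th_Lop_mono Th_taut) (simp add: tautology_def)
  moreover have "Neg (Lop t Bot) \<in> Th" using sr t by (intro Th_not_Lop_Bot) simp
  ultimately have a: "Neg (Lop t (Conj \<phi> (Neg \<phi>))) \<in> Th"
    by (rule Th_consequence2) auto
  have "Imp (Lop s (Conj \<phi> \<phi>)) (Lop s \<phi>) \<in> Th"
    by (intro Th_Lop_mono Th_taut) (simp add: tautology_def)
  with a have "Conj (Neg (Lop t (Conj \<phi> (Neg \<phi>)))) (Imp (Lop s (Conj \<phi> \<phi>)) (Lop s \<phi>)) \<in> Th"
    by (rule Th_consequence2) auto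
  from this sub show ?thesis by (rule Th_consequence2) auto
qed

section \<open>Saturated sets and their construction\<close>

text \<open>Closure under the rule with an antecedent \<open>\<psi>\<close> follows from this form: in a complete set
every implication with an absent antecedent is present.\<close>

definition saturated :: "'p fm set \<Rightarrow> bool" where
  "saturated u \<longleftrightarrow> Th \<subseteq> u \<and> (\<forall>\<phi>. Neg \<phi> \<in> u \<longleftrightarrow> \<phi> \<notin> u) \<and>
     (\<forall>\<phi> \<psi>. Conj \<phi> \<psi> \<in> u \<longleftrightarrow> \<phi> \<in> u \<and> \<psi> \<in> u) \<and>
     (\<forall>rs r \<phi>. (\<forall>s. rat_of s < rat_of r \<longrightarrow> Lops rs (Lop s \<phi>) \<in> u) \<longrightarrow> Lops rs (Lop r \<phi>) \<in> u)"

lemma saturated_Th: "saturated u \<Longrightarrow> \<phi> \<in> Th \<Longrightarrow> \<phi> \<in> u"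
  and saturated_Neg: "saturated u \<Longrightarrow> Neg \<phi> \<in> u \<longleftrightarrow> \<phi> \<notin> u"
  and saturated_Conj: "saturated u \<Longrightarrow> Conj \<phi> \<psi> \<in> u \<longleftrightarrow> \<phi> \<in> u \<and> \<psi> \<in> u"
  and saturated_GArch: "saturated u \<Longrightarrow> (\<And>s. rat_of s < rat_of r \<Longrightarrow> Lops rs (Lop s \<phi>) \<in> u)
    \<Longrightarrow> Lops rs (Lop r \<phi>) \<in> u"
  unfolding saturated_def by blast+

lemma saturated_Imp: "saturated u \<Longrightarrow> Imp \<phi> \<psi> \<in> u \<longleftrightarrow> (\<phi> \<in> u \<longrightarrow> \<psi> \<in> u)"
  by (simp add: Imp_def saturated_Neg saturated_Conj)

lemma saturated_Iff: "saturated u \<Longrightarrow> Iff \<phi> \<psi> \<in> u \<longleftrightarrow> (\<phi> \<in> u \<longleftrightarrow> \<psi> \<in> u)"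
  by (auto simp: Iff_def saturated_Imp saturated_Conj)

text \<open>A saturated set is an ultrafilter that meets countably many demands: for each formula, to contain it or
its negation; for each instance of the infinitary rule, to contain the conclusion or the negation of some
premise. The demands are met one after another by strengthening a formula \<open>\<delta>\<close>, and the
predicate \<open>P\<close> guarantees that this can go on and never leads to a contradiction. Keeping
\<open>P\<close> abstract gives control over the members of the resulting set.\<close>

lemma rasiowa_sikorski:
  assumes start: "P \<delta>\<^sub>0"
    and up: "\<And>\<delta> \<phi>. P \<delta> \<Longrightarrow> Imp \<delta> \<phi> \<in> Th \<Longrightarrow> P \<phi>"
    and consistent: "\<And>\<delta>. P \<delta> \<Longrightarrow> Neg \<delta> \<notin> Th"
    and split: "\<And>\<delta> \<phi>. P \<delta> \<Longrightarrow> P (Conj \<delta> \<phi>) \<or> P (Conj \<delta> (Neg \<phi>))"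
    and witness: "\<And>\<delta> rs r \<phi>. P \<delta> \<Longrightarrow> P (Conj \<delta> (Lops rs (Lop r \<phi>))) \<or>
      (\<exists>s. rat_of s < rat_of r \<and> P (Conj \<delta> (Neg (Lops rs (Lop s \<phi>)))))"
  shows "\<exists>u. saturated u \<and> \<delta>\<^sub>0 \<in> u \<and> (\<forall>\<phi> \<in> u. P \<phi>)"
proof -
  define demand :: "'p fm + index list \<times> index \<times> 'p fm \<Rightarrow> 'p fm set" where
    "demand e = (case e of Inl \<phi> \<Rightarrow> {\<phi>, Neg \<phi>}
       | Inr (rs, r, \<phi>) \<Rightarrow>
           insert (Lops rs (Lop r \<phi>)) {Neg (Lops rs (Lop s \<phi>)) | s. rat_of s < rat_of r})" for e
  have ex_pick: "\<exists>\<phi> \<in> demand e. P (Conj \<delta> \<phi>)" if "P \<delta>" for e \<delta>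
  proof (cases e)
    case (Inl \<phi>)
    then show ?thesis using split[OF that, of \<phi>] by (auto simp: demand_def)
  next
    case (Inr t)
    then show ?thesis using witness[OF that] by (cases t) (fastforce simp: demand_def)
  qed
  define pick where "pick e \<delta> = (SOME \<phi>. \<phi> \<in> demand e \<and> P (Conj \<delta> \<phi>))" for e \<delta>
  have pick: "pick e \<delta> \<in> demand e \<and> P (Conj \<delta> (pick e \<delta>))" if "P \<delta>" for e \<delta>
    using someI_ex[of "\<lambda>\<phi>. \<phi> \<in> demand e \<and> P (Conj \<delta> \<phi>)"] ex_pick[OF that, of e]
    unfolding pick_def by blast
  define chain where "chain = rec_nat \<delta>\<^sub>0 (\<lambda>n \<delta>. Conj \<delta> (pick (from_nat n) \<delta>))"
  have chain_simps: "chain 0 = \<delta>\<^sub>0"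
    "chain (Suc n) = Conj (chain n) (pick (from_nat n) (chain n))" for n
    by (simp_all add: chain_def)
  have P_chain: "P (chain n)" for n
    by (induction n) (use start pick in \<open>auto simp: chain_simps\<close>)
  have bool_chain: "bool_eval h (chain n) \<Longrightarrow> bool_eval h (chain m)" if "m \<le> n" for h m n
    using that by (induction n rule: dec_induct) (auto simp: chain_simps)
  define u where "u = {\<phi>. \<exists>n. Imp (chain n) \<phi> \<in> Th}"
  have uI: "\<phi> \<in> u" if "\<And>h. bool_eval h (chain n) \<Longrightarrow> bool_eval h \<phi>" for n \<phi>
    using that unfolding u_def by (auto intro!: exI[of _ n] Th_taut simp: tautology_def)
  have P_u: "P \<phi>" if "\<phi> \<in> u" for \<phi>
    using that up P_chain by (auto simp: u_def)
  have u_consequence2: "\<theta> \<in> u" if "\<phi> \<in> u" "\<psi> \<in> u"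
    "\<And>h. bool_eval h \<phi> \<Longrightarrow> bool_eval h \<psi> \<Longrightarrow> bool_eval h \<theta>" for \<phi> \<psi> \<theta>
  proof -
    from that obtain m n where mn: "Imp (chain m) \<phi> \<in> Th" "Imp (chain n) \<psi> \<in> Th"
      by (auto simp: u_def)
    have "Imp (chain (max m n)) \<theta> \<in> Th"
      using mn
    proof (rule Th_consequence2)
      fix h assume "bool_eval h (Imp (chain m) \<phi>)" "bool_eval h (Imp (chain n) \<psi>)"
      then show "bool_eval h (Imp (chain (max m n)) \<theta>)"
        using that(3)[of h] bool_chain[of m "max m n" h] bool_chain[of n "max m n" h] by auto
    qed
    then show ?thesis by (auto simp: u_def)
  qed
  have Bot: "Bot \<notin> u"
  proof
    assume "Bot \<in> u"
    then have "P Bot" by (rule P_u)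
    moreover have "Neg Bot \<in> Th" by (rule Th_taut) (simp add: tautology_def)
    ultimately show False using consistent by blast
  qed
  have demand: "\<exists>\<phi> \<in> demand e. \<phi> \<in> u" for e
  proof
    show "pick e (chain (to_nat e)) \<in> demand e" using pick P_chain by blast
    show "pick e (chain (to_nat e)) \<in> u"
      by (rule uI[of "Suc (to_nat e)"]) (simp add: chain_simps)
  qed
  have Neg: "Neg \<phi> \<in> u \<longleftrightarrow> \<phi> \<notin> u" for \<phi>
    using demand[of "Inl \<phi>"] Bot u_consequence2[of \<phi> "Neg \<phi>" Bot] by (auto simp: demand_def)
  have "Th \<subseteq> u"
  proof
    fix \<phi> assume "\<phi> \<in> Th"
    then have "Imp (chain 0) \<phi> \<in> Th" by (rule Th_consequence) simp
    then show "\<phi> \<in> u" unfolding u_def by blast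
  qed
  moreover have "Conj \<phi> \<psi> \<in> u \<longleftrightarrow> \<phi> \<in> u \<and> \<psi> \<in> u" for \<phi> \<psi>
  proof (intro iffI conjI)
    assume c: "Conj \<phi> \<psi> \<in> u"
    from c c show "\<phi> \<in> u" by (rule u_consequence2) simp
    from c c show "\<psi> \<in> u" by (rule u_consequence2) simp
  next
    assume "\<phi> \<in> u \<and> \<psi> \<in> u"
    then have "\<phi> \<in> u" "\<psi> \<in> u" by simp_all
    then show "Conj \<phi> \<psi> \<in> u" by (rule u_consequence2) simp
  qed
  moreover have "Lops rs (Lop r \<phi>) \<in> u"
    if "\<forall>s. rat_of s < rat_of r \<longrightarrow> Lops rs (Lop s \<phi>) \<in> u" for rs r \<phi>
    using demand[of "Inr (rs, r, \<phi>)"] that Neg by (auto simp: demand_def)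
  ultimately have "saturated u" unfolding saturated_def using Neg by blast
  moreover have "\<delta>\<^sub>0 \<in> u" by (rule uI[of 0]) (simp add: chain_simps)
  ultimately show ?thesis using P_u by blast
qed

text \<open>The predicate \<open>P\<close> is consistency with \<open>D\<close>. The demand for the infinitary rule can
be met because the rule is stated with an antecedent: if \<open>\<delta>\<close> is incompatible with the
negation of every premise, then \<open>D\<close> contains \<open>\<delta>\<close> implies each premise, hence
\<open>\<delta>\<close> implies the conclusion.\<close>

lemma lindenbaum:
  assumes D: "deductively_closed D" and "\<phi> \<notin> D"
  shows "\<exists>u. saturated u \<and> D \<subseteq> u \<and> \<phi> \<notin> u"
proof -
  have "\<exists>u. saturated u \<and> Neg \<phi> \<in> u \<and> (\<forall>\<psi> \<in> u. Neg \<psi> \<notin> D)"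
  proof (rule rasiowa_sikorski)
    show "Neg (Neg \<phi>) \<notin> D" using closed_consequence[OF D, of "Neg (Neg \<phi>)" \<phi>] assms(2) by auto
  next
    fix \<delta> \<psi> assume "Neg \<delta> \<notin> D" "Imp \<delta> \<psi> \<in> Th"
    moreover from this(2) have "Imp \<delta> \<psi> \<in> D" using D by (auto simp: deductively_closed_def)
    ultimately show "Neg \<psi> \<notin> D"
      using closed_consequence2[OF D, of "Imp \<delta> \<psi>" "Neg \<psi>" "Neg \<delta>"] by auto
  next
    fix \<delta> assume "Neg \<delta> \<notin> D"
    then show "Neg \<delta> \<notin> Th" using D by (auto simp: deductively_closed_def)
  next
    fix \<delta> \<psi> assume "Neg \<delta> \<notin> D"
    then show "Neg (Conj \<delta> \<psi>) \<notin> D \<or> Neg (Conj \<delta> (Neg \<psi>)) \<notin> D"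
      using closed_consequence2[OF D, of "Neg (Conj \<delta> \<psi>)" "Neg (Conj \<delta> (Neg \<psi>))" "Neg \<delta>"]
      by auto
  next
    fix \<delta> rs r \<psi> assume \<delta>: "Neg \<delta> \<notin> D"
    show "Neg (Conj \<delta> (Lops rs (Lop r \<psi>))) \<notin> D \<or>
      (\<exists>s. rat_of s < rat_of r \<and> Neg (Conj \<delta> (Neg (Lops rs (Lop s \<psi>)))) \<notin> D)"
    proof (rule ccontr)
      assume *: "\<not> ?thesis"
      then have "Imp \<delta> (Lops rs (Lop s \<psi>)) \<in> D" if "rat_of s < rat_of r" for s
        using that by (auto simp: Imp_def)
      then have "Imp \<delta> (Lops rs (Lop r \<psi>)) \<in> D" by (rule closed_GArch[OF D])
      moreover have "Neg (Conj \<delta> (Lops rs (Lop r \<psi>))) \<in> D" using * by blast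
      ultimately have "Neg \<delta> \<in> D" by (rule closed_consequence2[OF D]) auto
      with \<delta> show False ..
    qed
  qed
  then obtain u where u: "saturated u" "Neg \<phi> \<in> u" "\<And>\<psi>. \<psi> \<in> u \<Longrightarrow> Neg \<psi> \<notin> D" by blast
  have "\<psi> \<in> u" if "\<psi> \<in> D" for \<psi>
  proof (rule ccontr)
    assume "\<psi> \<notin> u"
    then have "Neg \<psi> \<in> u" using u(1) by (simp add: saturated_Neg)
    then have "Neg (Neg \<psi>) \<notin> D" by (rule u(3))
    with that closed_consequence[OF D, of \<psi> "Neg (Neg \<psi>)"] show False by auto
  qed
  with u show ?thesis by (auto simp: saturated_Neg)
qed

section \<open>The finitely additive probability of a saturated set\<close>

text \<open>The probability that a saturated set \<open>w\<close> assigns to \<open>\<phi>\<close>; it becomes the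
measure of the truth set of \<open>\<phi>\<close> under the kernel at \<open>w\<close>.\<close>

definition mass :: "'p fm set \<Rightarrow> 'p fm \<Rightarrow> real" where
  "mass w \<phi> = Sup (val ` {r. Lop r \<phi> \<in> w})"

context
  fixes w assumes w: "saturated w"
begin

lemma saturated_mp: "Imp \<phi> \<psi> \<in> Th \<Longrightarrow> \<phi> \<in> w \<Longrightarrow> \<psi> \<in> w"
  using saturated_Th[OF w] saturated_Imp[OF w] by blast

lemma mass_set:
  "bdd_above (val ` {r. Lop r \<phi> \<in> w})" "val ` {r. Lop r \<phi> \<in> w} \<noteq> {}"
proof -
  show "bdd_above (val ` {r. Lop r \<phi> \<in> w})"
    using val_bounds by (auto intro: bdd_aboveI[of _ 1])
  have "Lop (mk_index 0) \<phi> \<in> w"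
    using Th_Lops_0[of "mk_index 0" "[]"] saturated_Th[OF w] by simp
  then show "val ` {r. Lop r \<phi> \<in> w} \<noteq> {}" by blast
qed

text \<open>The infinitary rule with empty prefix gives \<open>Lop r \<phi>\<close> also when \<open>r\<close> is only
approached from below by the indices in the supremum.\<close>

lemma mass_ge_iff: "val r \<le> mass w \<phi> \<longleftrightarrow> Lop r \<phi> \<in> w"
proof
  assume r: "val r \<le> mass w \<phi>"
  have "Lop s \<phi> \<in> w" if "rat_of s < rat_of r" for s
  proof -
    have "val s < mass w \<phi>" using that r by (meson of_rat_less less_le_trans)
    then obtain r' where r': "Lop r' \<phi> \<in> w" "val s < val r'"
      unfolding mass_def less_cSup_iff[OF mass_set(2,1)] by blast
    then show ?thesis
      using saturated_mp[OF Th_Lop_antimono] by (metis less_imp_le of_rat_less)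
  qed
  then show "Lop r \<phi> \<in> w" using saturated_GArch[OF w, of r "[]" \<phi>] by simp
next
  assume "Lop r \<phi> \<in> w"
  then show "val r \<le> mass w \<phi>"
    unfolding mass_def by (intro cSup_upper mass_set) blast
qed

lemma mass_nonneg: "0 \<le> mass w \<phi>"
  using mass_ge_iff[of "mk_index 0" \<phi>] Th_Lops_0[of "mk_index 0" "[]" \<phi>] saturated_Th[OF w] by simp

lemma mass_le_1: "mass w \<phi> \<le> 1"
  unfolding mass_def by (rule cSup_least[OF mass_set(2)]) (use val_bounds in auto)

lemma mass_mono:
  assumes "Imp \<phi> \<psi> \<in> Th"
  shows "mass w \<phi> \<le> mass w \<psi>"
  unfolding mass_def
  by (rule cSup_subset_mono[OF mass_set(2,1)]) (use saturated_mp[OF Th_Lop_mono[OF assms]] in blast)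

lemma mass_mono_taut: "(\<And>h. bool_eval h \<phi> \<Longrightarrow> bool_eval h \<psi>) \<Longrightarrow> mass w \<phi> \<le> mass w \<psi>"
  by (intro mass_mono Th_taut_Imp)

lemma mass_Th:
  assumes "\<phi> \<in> Th"
  shows "mass w \<phi> = 1"
  using mass_ge_iff[of "mk_index 1" \<phi>] saturated_Th[OF w Th_Lop_1[OF assms]] mass_le_1[of \<phi>] by simp

lemma ex_index_below:
  assumes "0 \<le> a" "a \<le> 1" "0 < e"
  obtains r where "a - e < val r" "val r \<le> a"
proof (cases "a = 0")
  case True
  then show ?thesis using that[of "mk_index 0"] assms by simp
next
  case False
  then obtain r where "max 0 (a - e) < val r" "val r < a"
    using ex_index_between[of "max 0 (a - e)" a] assms by auto
  then show ?thesis using that[of r] by simp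
qed

text \<open>Finite additivity, from the two additivity axioms. These concern only indices with sum at most 1, so the
inequality ``at least'' must also exclude that the two parts have total mass above 1; this is the task of
the axiom relating \<open>Lop r (Neg \<phi>)\<close> to \<open>Neg (Lop s \<phi>)\<close>.\<close>

lemma mass_split: "mass w \<phi> = mass w (Conj \<phi> \<psi>) + mass w (Conj \<phi> (Neg \<psi>))"
proof (rule antisym)
  let ?a = "mass w (Conj \<phi> \<psi>)" and ?b = "mass w (Conj \<phi> (Neg \<psi>))"
  show "mass w \<phi> \<le> ?a + ?b"
  proof (rule ccontr)
    assume ccontr: "\<not> ?thesis"
    define e where "e = (mass w \<phi> - ?a - ?b) / 2"
    have e: "0 < e" "?a + ?b + 2 * e = mass w \<phi>" "?a + ?b < 1"
      using ccontr mass_le_1[of \<phi>] by (auto simp: e_def field_simps)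
    have "?a < 1" "?b < 1" using e(3) mass_nonneg[of "Conj \<phi> \<psi>"] mass_nonneg[of "Conj \<phi> (Neg \<psi>)"] by linarith+
    then obtain r s where r: "?a < val r" "val r < ?a + e" and s: "?b < val s" "val s < ?b + e"
      using ex_index_between[of ?a "?a + e"] ex_index_between[of ?b "?b + e"] e(1) mass_nonneg
      by (metis less_add_same_cancel1)
    have lt: "val r + val s < mass w \<phi>" using r s e by linarith
    then have "real_of_rat (rat_of r + rat_of s) \<le> 1"
      using mass_le_1[of \<phi>] by (simp add: of_rat_add)
    then have le: "rat_of r + rat_of s \<le> 1" by (simp only: of_rat_le_1_iff)
    have "0 \<le> rat_of r + rat_of s" using rat_of_bounds by simp
    with le have v: "val (mk_index (rat_of r + rat_of s)) = val r + val s" by (simp add: of_rat_add)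
    have "Lop r (Conj \<phi> \<psi>) \<notin> w" "Lop s (Conj \<phi> (Neg \<psi>)) \<notin> w"
      using r s by (simp_all add: mass_ge_iff[symmetric])
    moreover note saturated_Th[OF w subsetD[OF axioms_M_in axioms_M.LSubadd[OF le, of \<phi> \<psi>]]]
    ultimately have "Lop (mk_index (rat_of r + rat_of s)) \<phi> \<notin> w"
      by (simp add: saturated_Imp[OF w] saturated_Conj[OF w] saturated_Neg[OF w])
    with lt v show False by (simp add: mass_ge_iff[symmetric])
  qed
  show "?a + ?b \<le> mass w \<phi>"
  proof (rule ccontr)
    assume ccontr: "\<not> ?thesis"
    define e where "e = (?a + ?b - mass w \<phi>) / 2"
    have e: "0 < e" "?a + ?b - 2 * e = mass w \<phi>"
      using ccontr by (auto simp: e_def field_simps)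
    obtain r where r: "?a - e < val r" "val r \<le> ?a"
      using ex_index_below[OF mass_nonneg mass_le_1 e(1)] .
    obtain s where s: "?b - e < val s" "val s \<le> ?b"
      using ex_index_below[OF mass_nonneg mass_le_1 e(1)] .
    have gt: "mass w \<phi> < val r + val s" using r s e by linarith
    have in_w: "Lop r (Conj \<phi> \<psi>) \<in> w" "Lop s (Conj \<phi> (Neg \<psi>)) \<in> w"
      using r s by (simp_all add: mass_ge_iff[symmetric])
    show False
    proof (cases "rat_of r + rat_of s \<le> 1")
      case True
      have "0 \<le> rat_of r + rat_of s" using rat_of_bounds by simp
      with True have v: "val (mk_index (rat_of r + rat_of s)) = val r + val s" by (simp add: of_rat_add)
      have "Lop (mk_index (rat_of r + rat_of s)) \<phi> \<in> w"
        using saturated_Th[OF w subsetD[OF axioms_M_in axioms_M.LAdd[OF True, of \<phi> \<psi>]]] in_w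
        by (simp add: saturated_Imp[OF w] saturated_Conj[OF w])
      with gt v show False by (simp add: mass_ge_iff[symmetric])
    next
      case False
      then have gt1: "rat_of s + rat_of r > 1" by simp
      have "Imp (Conj \<phi> (Neg \<psi>)) (Neg (Conj \<phi> \<psi>)) \<in> Th" by (rule Th_taut_Imp) simp
      from saturated_mp[OF Th_Lop_mono[OF this] in_w(2)]
      have "Neg (Lop r (Conj \<phi> \<psi>)) \<in> w"
        using saturated_mp[OF subsetD[OF axioms_M_in axioms_M.LNeg[OF gt1]]] by blast
      with in_w(1) show False by (simp add: saturated_Neg[OF w])
    qed
  qed
qed

lemma mass_refutable:
  assumes "Neg \<phi> \<in> Th"
  shows "mass w \<phi> = 0"
proof -
  have "Imp (Neg \<phi>) (Conj (Neg Bot) (Neg \<phi>)) \<in> Th" by (rule Th_taut_Imp) simp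
  with assms have "mass w (Conj (Neg Bot) (Neg \<phi>)) = 1" by (intro mass_Th) (rule Th_mp)
  moreover have "mass w (Neg Bot) = 1" by (intro mass_Th Th_taut) (simp add: tautology_def)
  moreover have "mass w \<phi> \<le> mass w (Conj (Neg Bot) \<phi>)" by (rule mass_mono_taut) simp
  ultimately show ?thesis
    using mass_split[of "Neg Bot" \<phi>] mass_nonneg[of \<phi>] by simp
qed

text \<open>The mass of the event that an instance of the infinitary rule has its premise for \<open>s\<close> true and
its conclusion false can be made arbitrarily small. Otherwise some index \<open>t\<close> separates the mass of
the conclusion from the masses of all premises, and the instance of the rule with prefix
\<open>t # rs\<close> fails in \<open>w\<close>.\<close>

lemma mass_Lops_gap:
  assumes "0 < e" "0 < rat_of r"
  shows "\<exists>s. rat_of s < rat_of r \<and> mass w (Conj (Lops rs (Lop s \<phi>)) (Neg (Lops rs (Lop r \<phi>)))) < e"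
proof (rule ccontr)
  let ?m = "mass w (Lops rs (Lop r \<phi>))"
  assume "\<not> ?thesis"
  then have gap: "e \<le> mass w (Conj (Lops rs (Lop s \<phi>)) (Neg (Lops rs (Lop r \<phi>))))"
    if "rat_of s < rat_of r" for s
    using that by (meson not_less)
  have low: "?m + e \<le> mass w (Lops rs (Lop s \<phi>))" if s: "rat_of s < rat_of r" for s
  proof -
    have "Imp (Lops rs (Lop r \<phi>)) (Lops rs (Lop s \<phi>)) \<in> Th"
      using s by (intro Th_Lops_mono Th_Lop_antimono) simp
    then have "Imp (Lops rs (Lop r \<phi>)) (Conj (Lops rs (Lop s \<phi>)) (Lops rs (Lop r \<phi>))) \<in> Th"
      by (rule Th_consequence) simp
    then have "?m \<le> mass w (Conj (Lops rs (Lop s \<phi>)) (Lops rs (Lop r \<phi>)))" by (rule mass_mono)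
    with gap[OF s] mass_split[of "Lops rs (Lop s \<phi>)" "Lops rs (Lop r \<phi>)"] show ?thesis by simp
  qed
  have "rat_of (mk_index 0) < rat_of r" using assms(2) by simp
  from low[OF this] have "?m + e \<le> 1" using mass_le_1[of "Lops rs (Lop (mk_index 0) \<phi>)"] by simp
  then obtain t where t: "?m < val t" "val t < ?m + e"
    using ex_index_between[of ?m "?m + e"] assms(1) mass_nonneg[of "Lops rs (Lop r \<phi>)"] by auto
  have "Lops (t # rs) (Lop s \<phi>) \<in> w" if "rat_of s < rat_of r" for s
    using low[OF that] t(2) by (simp add: mass_ge_iff[symmetric])
  then have "Lops (t # rs) (Lop r \<phi>) \<in> w" by (rule saturated_GArch[OF w])
  with t(1) show False by (simp add: mass_ge_iff[symmetric])
qed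

text \<open>The core of countable additivity: a decreasing sequence whose masses stay above a positive bound has a
common world. The predicate \<open>P\<close> says that cutting down by \<open>\<delta>\<close> still leaves a
positive amount of mass in the limit. If the conclusion of an instance of the infinitary rule cannot be
added to \<open>\<delta>\<close>, its negation can, leaving mass at least some positive \<open>d\<close>;
by \<open>mass_Lops_gap\<close> some premise can then be negated as well at a cost below
\<open>d / 2\<close>.\<close>

lemma mass_realised:
  fixes \<theta> :: "nat \<Rightarrow> 'p fm"
  assumes e: "0 < e" "\<And>n. e \<le> mass w (\<theta> n)"
    and dec: "\<And>m n. m \<le> n \<Longrightarrow> Imp (\<theta> n) (\<theta> m) \<in> Th"
  shows "\<exists>u. saturated u \<and> (\<forall>n. \<theta> n \<in> u)"
proof -
  define P where "P \<delta> \<longleftrightarrow> (\<exists>e>0. \<forall>n. e \<le> mass w (Conj (\<theta> n) \<delta>))" for \<delta>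
  have P_I: "P \<delta>" if "0 < e" "\<And>n. e \<le> mass w (Conj (\<theta> n) \<delta>)" for \<delta> e
    using that by (auto simp: P_def)
  have refutable: "\<not> P \<delta>" if "Neg \<delta> \<in> Th" for \<delta>
  proof -
    have "Neg (Conj (\<theta> 0) \<delta>) \<in> Th" using that by (rule Th_consequence) simp
    then show ?thesis using mass_refutable[of "Conj (\<theta> 0) \<delta>"] unfolding P_def by (metis not_less)
  qed
  have split: "P (Conj \<delta> \<phi>) \<or> P (Conj \<delta> (Neg \<phi>))" if P: "P \<delta>" for \<delta> \<phi>
  proof (rule ccontr)
    assume neither: "\<not> ?thesis"
    obtain d where d: "0 < d" "\<forall>n. d \<le> mass w (Conj (\<theta> n) \<delta>)" using P unfolding P_def by blast
    have "\<exists>m. mass w (Conj (\<theta> m) \<psi>) < d / 2" if "\<not> P \<psi>" for \<psi>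
      using that P_I[of "d / 2" \<psi>] d(1) by (meson half_gt_zero not_le)
    from this[of "Conj \<delta> \<phi>"] this[of "Conj \<delta> (Neg \<phi>)"] neither
    obtain m n where mn: "mass w (Conj (\<theta> m) (Conj \<delta> \<phi>)) < d / 2"
      "mass w (Conj (\<theta> n) (Conj \<delta> (Neg \<phi>))) < d / 2" by blast
    let ?k = "max m n"
    have "mass w (Conj (Conj (\<theta> ?k) \<delta>) \<phi>) \<le> mass w (Conj (\<theta> m) (Conj \<delta> \<phi>))"
      by (intro mass_mono Th_consequence[OF dec[of m ?k]]) simp_all
    moreover have "mass w (Conj (Conj (\<theta> ?k) \<delta>) (Neg \<phi>)) \<le> mass w (Conj (\<theta> n) (Conj \<delta> (Neg \<phi>)))"
      by (intro mass_mono Th_consequence[OF dec[of n ?k]]) simp_all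
    ultimately show False
      using mass_split[of "Conj (\<theta> ?k) \<delta>" \<phi>] spec[OF d(2), of ?k] mn by linarith
  qed
  have "\<exists>u. saturated u \<and> Neg Bot \<in> u \<and> (\<forall>\<phi> \<in> u. P \<phi>)"
  proof (rule rasiowa_sikorski)
    have "mass w (\<theta> n) \<le> mass w (Conj (\<theta> n) (Neg Bot))" for n by (rule mass_mono_taut) simp
    then show "P (Neg Bot)" using e by (meson P_I order_trans)
  next
    fix \<delta> \<phi> assume "P \<delta>" and imp: "Imp \<delta> \<phi> \<in> Th"
    have "mass w (Conj (\<theta> n) \<delta>) \<le> mass w (Conj (\<theta> n) \<phi>)" for n
      by (intro mass_mono Th_consequence[OF imp]) simp
    with \<open>P \<delta>\<close> show "P \<phi>" unfolding P_def by (meson order_trans)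
  next
    fix \<delta> rs r and \<phi> :: "'p fm" assume "P \<delta>"
    let ?r = "Lops rs (Lop r \<phi>)"
    let ?s = "\<lambda>s. Lops rs (Lop s \<phi>)"
    \<comment> \<open>The index \<open>r\<close> is positive once the conclusion can be negated, since with index 0 it is a theorem.\<close>
    show "P (Conj \<delta> ?r) \<or> (\<exists>s. rat_of s < rat_of r \<and> P (Conj \<delta> (Neg (?s s))))"
    proof (cases "P (Conj \<delta> (Neg ?r))")
      case True
      then obtain d where d: "0 < d" "\<And>n. d \<le> mass w (Conj (\<theta> n) (Conj \<delta> (Neg ?r)))"
        by (auto simp: P_def)
      have "rat_of r \<noteq> 0"
      proof
        assume "rat_of r = 0"
        then have "?r \<in> Th" by (rule Th_Lops_0)
        then have "Neg (Conj \<delta> (Neg ?r)) \<in> Th" by (rule Th_consequence) simp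
        with True refutable show False by blast
      qed
      with rat_of_bounds[of r] have "0 < rat_of r" by simp
      then obtain s where s: "rat_of s < rat_of r" "mass w (Conj (?s s) (Neg ?r)) < d / 2"
        using mass_Lops_gap[of "d / 2" r rs \<phi>] d(1) by auto
      have "d / 2 \<le> mass w (Conj (\<theta> n) (Conj \<delta> (Neg (?s s))))" for n
      proof -
        let ?c = "Conj (\<theta> n) (Conj \<delta> (Neg ?r))"
        have "mass w (Conj ?c (?s s)) \<le> mass w (Conj (?s s) (Neg ?r))"
          by (rule mass_mono_taut) simp
        moreover have "mass w (Conj ?c (Neg (?s s))) \<le> mass w (Conj (\<theta> n) (Conj \<delta> (Neg (?s s))))"
          by (rule mass_mono_taut) simp
        ultimately show ?thesis using mass_split[of ?c "?s s"] d(2)[of n] s(2) by linarith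
      qed
      then have "P (Conj \<delta> (Neg (?s s)))" using d(1) by (intro P_I[of "d / 2"]) simp_all
      with s(1) show ?thesis by blast
    next
      case False
      with split[OF \<open>P \<delta>\<close>, of ?r] show ?thesis by blast
    qed
  qed (use refutable split in blast)+
  then obtain u where u: "saturated u" "\<And>\<phi>. \<phi> \<in> u \<Longrightarrow> P \<phi>" by blast
  have "\<theta> n \<in> u" for n
  proof (rule ccontr)
    assume "\<theta> n \<notin> u"
    then have "P (Neg (\<theta> n))" using u by (simp add: saturated_Neg)
    moreover have "Neg (Conj (\<theta> n) (Neg (\<theta> n))) \<in> Th" by (rule Th_taut) (simp add: tautology_def)
    from mass_refutable[OF this] have "\<not> P (Neg (\<theta> n))" unfolding P_def by (metis not_less)
    ultimately show False by blast
  qed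
  with u(1) show ?thesis by blast
qed

end

section \<open>The canonical process\<close>

definition successor :: "'p fm set \<Rightarrow> 'p fm set" where
  "successor u = {\<phi>. Next \<phi> \<in> u}"

lemma axioms_M_saturated: "saturated u \<Longrightarrow> \<phi> \<in> axioms_M \<Longrightarrow> \<phi> \<in> u"
  using axioms_M_in saturated_Th by blast

lemma Next_Neg_saturated: "saturated u \<Longrightarrow> Next (Neg \<phi>) \<in> u \<longleftrightarrow> Next \<phi> \<notin> u"
  using axioms_M_saturated[OF _ axioms_M.NextNeg] by (simp add: saturated_Iff saturated_Neg)

lemma Next_Conj_saturated:
  "saturated u \<Longrightarrow> Next (Conj \<phi> \<psi>) \<in> u \<longleftrightarrow> Next \<phi> \<in> u \<and> Next \<psi> \<in> u"
  using axioms_M_saturated[OF _ axioms_M.NextConj] by (simp add: saturated_Iff saturated_Conj)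

lemma Lop_Next_saturated: "saturated u \<Longrightarrow> Lop r (Next \<phi>) \<in> u \<longleftrightarrow> Next (Lop r \<phi>) \<in> u"
  using axioms_M_saturated[OF _ axioms_M.M] by (simp add: saturated_Iff)

lemma Lops_Next_Th:
  "Imp (Lops rs (Next \<phi>)) (Next (Lops rs \<phi>)) \<in> Th \<and> Imp (Next (Lops rs \<phi>)) (Lops rs (Next \<phi>)) \<in> Th"
proof (induction rs)
  case Nil
  then show ?case using Th_taut_Imp[of "Next \<phi>" "Next \<phi>"] by simp
next
  case (Cons r rs)
  have M: "Iff (Lop r (Next (Lops rs \<phi>))) (Next (Lop r (Lops rs \<phi>))) \<in> Th"
    using axioms_M.M axioms_M_in by blast
  note to = Th_Lop_mono[OF conjunct1[OF Cons.IH], of r]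
  note fro = Th_Lop_mono[OF conjunct2[OF Cons.IH], of r]
  from Th_consequence2[OF to M] Th_consequence2[OF fro M] show ?case
    by (simp add: Iff_def)
qed

lemma Lops_Next_saturated: "saturated u \<Longrightarrow> Lops rs (Next \<phi>) \<in> u \<longleftrightarrow> Next (Lops rs \<phi>) \<in> u"
  using Lops_Next_Th[of rs \<phi>] saturated_mp by blast

text \<open>The infinitary rule passes to the shifted set because axiom M moves \<open>Next\<close> through the whole
prefix of \<open>L\<close>-operators.\<close>

lemma saturated_successor:
  assumes u: "saturated u"
  shows "saturated (successor u)"
proof -
  have "Lops rs (Lop r \<phi>) \<in> successor u"
    if "\<forall>s. rat_of s < rat_of r \<longrightarrow> Lops rs (Lop s \<phi>) \<in> successor u" for rs r \<phi>
  proof -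
    have shift: "Lops rs (Lop s \<phi>) \<in> successor u \<longleftrightarrow> Lops rs (Lop s (Next \<phi>)) \<in> u" for s
      using Lops_Next_saturated[OF u, of "rs @ [s]" \<phi>] by (simp add: successor_def Lops_def)
    from that have "\<And>s. rat_of s < rat_of r \<Longrightarrow> Lops rs (Lop s (Next \<phi>)) \<in> u" by (simp add: shift)
    then show ?thesis unfolding shift by (rule saturated_GArch[OF u])
  qed
  moreover have "Th \<subseteq> successor u" using Th_Next saturated_Th[OF u] by (auto simp: successor_def)
  ultimately show ?thesis
    unfolding saturated_def[of "successor u"]
    by (simp add: successor_def Next_Neg_saturated[OF u] Next_Conj_saturated[OF u])
qed

lemma mass_successor: "saturated u \<Longrightarrow> mass (successor u) \<phi> = mass u (Next \<phi>)"
  by (simp add: mass_def successor_def Lop_Next_saturated)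

end

text \<open>The worlds are elements of the given type \<open>'w\<close> that code saturated sets, so that the canonical
process lives on that type from the start.\<close>

locale canonical_model = dpl_logic Th for Th :: "'p::countable fm set" +
  fixes enc :: "'p fm set \<Rightarrow> 'w"
  assumes inj_enc: "inj enc"
begin

definition worlds :: "'w set" where
  "worlds = enc ` {u. saturated u}"

abbreviation theory_of :: "'w \<Rightarrow> 'p fm set" where
  "theory_of \<equiv> inv enc"

definition truth_set :: "'p fm \<Rightarrow> 'w set" where
  "truth_set \<phi> = {x \<in> worlds. \<phi> \<in> theory_of x}"

lemma theory_of_enc [simp]: "theory_of (enc u) = u"
  using inj_enc by (rule inv_f_f)

lemma saturated_theory_of: "x \<in> worlds \<Longrightarrow> saturated (theory_of x)"
  by (auto simp: worlds_def)

lemma truth_set_subset: "truth_set \<phi> \<subseteq> worlds"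
  by (auto simp: truth_set_def)

lemma truth_set_Neg: "truth_set (Neg \<phi>) = worlds - truth_set \<phi>"
  by (auto simp: truth_set_def saturated_Neg[OF saturated_theory_of])

lemma truth_set_Conj: "truth_set (Conj \<phi> \<psi>) = truth_set \<phi> \<inter> truth_set \<psi>"
  by (auto simp: truth_set_def saturated_Conj[OF saturated_theory_of])

lemma truth_set_Bot: "truth_set Bot = {}"
  by (auto simp: Bot_def Let_def truth_set_Conj truth_set_Neg)

text \<open>By the Lindenbaum lemma, truth sets faithfully represent formulas up to provable equivalence. Hence
\<open>mass\<close> depends only on the truth set, and decreasing sequences of truth sets come from
decreasing sequences of formulas.\<close>

lemma truth_set_mono_iff: "truth_set \<phi> \<subseteq> truth_set \<psi> \<longleftrightarrow> Imp \<phi> \<psi> \<in> Th"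
proof
  assume sub: "truth_set \<phi> \<subseteq> truth_set \<psi>"
  show "Imp \<phi> \<psi> \<in> Th"
  proof (rule ccontr)
    assume "Imp \<phi> \<psi> \<notin> Th"
    then obtain u where u: "saturated u" "Imp \<phi> \<psi> \<notin> u"
      using lindenbaum[OF deductively_closed_Th] by blast
    then have "enc u \<in> truth_set \<phi>" "enc u \<notin> truth_set \<psi>"
      by (auto simp: truth_set_def worlds_def saturated_Imp)
    with sub show False by blast
  qed
next
  assume "Imp \<phi> \<psi> \<in> Th"
  then show "truth_set \<phi> \<subseteq> truth_set \<psi>"
    using saturated_mp[OF saturated_theory_of] by (auto simp: truth_set_def)
qed

lemma algebra_truth_sets: "algebra worlds (range truth_set)"
  unfolding algebra_iff_Int
proof (intro conjI ballI)
  show "range truth_set \<subseteq> Pow worlds" using truth_set_subset by blast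
  show "{} \<in> range truth_set" using truth_set_Bot rangeI[of truth_set Bot] by simp
  show "worlds - a \<in> range truth_set" if "a \<in> range truth_set" for a
    using that by (auto simp: truth_set_Neg[symmetric])
  show "a \<inter> b \<in> range truth_set" if "a \<in> range truth_set" "b \<in> range truth_set" for a b
    using that by (auto simp: truth_set_Conj[symmetric])
qed

lemma truth_sets_Pow: "range truth_set \<subseteq> Pow worlds"
  using truth_set_subset by blast

text \<open>For a finitely additive finite set function on an algebra, countable additivity amounts to continuity at
the empty set: if the masses of a decreasing sequence did not tend to 0, \<open>mass_realised\<close> would
provide a world in the intersection.\<close>

lemma ex_kernel:
  assumes u: "saturated u"
  shows "\<exists>K. space K = worlds \<and> sets K = sigma_sets worlds (range truth_set) \<and>
    (\<forall>\<phi>. emeasure K (truth_set \<phi>) = ennreal (mass u \<phi>))"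
proof -
  interpret A: algebra worlds "range truth_set" by (rule algebra_truth_sets)
  define f where "f S = ennreal (mass u (SOME \<phi>. truth_set \<phi> = S))" for S
  have cong: "mass u \<phi> = mass u \<psi>" if "truth_set \<phi> = truth_set \<psi>" for \<phi> \<psi>
    using that by (intro antisym mass_mono[OF u]) (simp_all add: truth_set_mono_iff[symmetric])
  have f: "f (truth_set \<phi>) = ennreal (mass u \<phi>)" for \<phi>
    unfolding f_def by (intro arg_cong[where f = ennreal] cong someI) (rule refl)
  have Bot: "mass u Bot = 0"
    by (intro mass_refutable[OF u] Th_taut) (simp add: tautology_def)
  have "\<exists>\<mu>. (\<forall>S \<in> range truth_set. \<mu> S = f S) \<and>
    measure_space worlds (sigma_sets worlds (range truth_set)) \<mu>"
  proof (rule A.caratheodory_empty_continuous)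
    show "positive (range truth_set) f"
      using f[of Bot] Bot by (simp add: positive_def truth_set_Bot)
    show "additive (range truth_set) f"
      unfolding additive_def
    proof (intro ballI impI)
      fix S T assume "S \<in> range truth_set" "T \<in> range truth_set" and disj: "S \<inter> T = {}"
      then obtain \<phi> \<psi> where S: "S = truth_set \<phi>" and T: "T = truth_set \<psi>" by blast
      let ?or = "Neg (Conj (Neg \<phi>) (Neg \<psi>))"
      have or: "truth_set ?or = S \<union> T"
        unfolding truth_set_Neg truth_set_Conj S T using truth_set_subset by blast
      have "truth_set (Conj ?or \<phi>) = S" "truth_set (Conj ?or (Neg \<phi>)) = T"
        unfolding truth_set_Conj or unfolding truth_set_Neg S T
        using disj truth_set_subset unfolding S T by blast+
      then have "mass u (Conj ?or \<phi>) = mass u \<phi>" "mass u (Conj ?or (Neg \<phi>)) = mass u \<psi>"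
        unfolding S T by (blast intro: cong)+
      then have "mass u ?or = mass u \<phi> + mass u \<psi>" using mass_split[OF u, of ?or \<phi>] by simp
      then show "f (S \<union> T) = f S + f T"
        unfolding or[symmetric] unfolding S T f using mass_nonneg[OF u] by simp
    qed
    show "f S \<noteq> \<infinity>" if "S \<in> range truth_set" for S
      using that f by auto
    fix A :: "nat \<Rightarrow> 'w set"
    assume "range A \<subseteq> range truth_set" and dec: "decseq A" and empty: "(\<Inter>i. A i) = {}"
    then have "\<forall>i. \<exists>\<phi>. A i = truth_set \<phi>" by blast
    then obtain \<theta> where \<theta>: "\<And>i. A i = truth_set (\<theta> i)" by metis
    have imp: "Imp (\<theta> n) (\<theta> m) \<in> Th" if "m \<le> n" for m n
      using decseqD[OF dec that] by (simp add: \<theta> truth_set_mono_iff)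
    have "(\<lambda>i. mass u (\<theta> i)) \<longlonglongrightarrow> 0"
    proof (rule LIMSEQ_I)
      fix e :: real assume "0 < e"
      have "\<exists>n. mass u (\<theta> n) < e"
      proof (rule ccontr)
        assume "\<not> ?thesis"
        then have "\<And>n. e \<le> mass u (\<theta> n)" by (auto simp: not_less)
        from mass_realised[of u e \<theta>, OF u \<open>0 < e\<close> this imp] obtain u'
          where "saturated u'" "\<forall>n. \<theta> n \<in> u'" by blast
        then have "enc u' \<in> (\<Inter>i. A i)" by (simp add: \<theta> truth_set_def worlds_def)
        with empty show False by blast
      qed
      then obtain N where N: "mass u (\<theta> N) < e" by blast
      have "norm (mass u (\<theta> n) - 0) < e" if "N \<le> n" for n
        using mass_mono[OF u imp[OF that]] mass_nonneg[OF u, of "\<theta> n"] N by simp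
      then show "\<exists>no. \<forall>n\<ge>no. norm (mass u (\<theta> n) - 0) < e" by blast
    qed
    then have "(\<lambda>i. ennreal (mass u (\<theta> i))) \<longlonglongrightarrow> ennreal 0" by (rule tendsto_ennrealI)
    then show "(\<lambda>i. f (A i)) \<longlonglongrightarrow> 0" by (simp add: \<theta> f)
  qed
  then obtain \<mu> where \<mu>: "\<And>\<phi>. \<mu> (truth_set \<phi>) = ennreal (mass u \<phi>)"
    and ms: "measure_space worlds (sigma_sets worlds (range truth_set)) \<mu>"
    using f by auto
  let ?K = "measure_of worlds (range truth_set) \<mu>"
  have "emeasure ?K (truth_set \<phi>) = ennreal (mass u \<phi>)" for \<phi>
    using emeasure_measure_of[of ?K worlds "range truth_set" \<mu> "truth_set \<phi>"] ms truth_sets_Pow \<mu>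
    by (simp add: measure_space_def)
  then show ?thesis using truth_sets_Pow by (intro exI[of _ ?K]) simp
qed

definition canonical_kernel :: "'w \<Rightarrow> 'w measure" where
  "canonical_kernel x = (SOME K. space K = worlds \<and> sets K = sigma_sets worlds (range truth_set) \<and>
    (\<forall>\<phi>. emeasure K (truth_set \<phi>) = ennreal (mass (theory_of x) \<phi>)))"

lemma canonical_kernel:
  assumes "x \<in> worlds"
  shows "space (canonical_kernel x) = worlds"
    "sets (canonical_kernel x) = sigma_sets worlds (range truth_set)"
    "emeasure (canonical_kernel x) (truth_set \<phi>) = ennreal (mass (theory_of x) \<phi>)"
  using someI_ex[OF ex_kernel[OF saturated_theory_of[OF assms]]]
  unfolding canonical_kernel_def[symmetric] by blast+

lemma measure_canonical_kernel:
  "x \<in> worlds \<Longrightarrow> measure (canonical_kernel x) (truth_set \<phi>) = mass (theory_of x) \<phi>"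
  using canonical_kernel(3) mass_nonneg[OF saturated_theory_of] by (simp add: measure_def)

definition canonical_process :: "'w process" where
  "canonical_process = \<lparr>events = sigma worlds (range truth_set), kern = canonical_kernel,
     dyn = (\<lambda>x. enc (successor (theory_of x)))\<rparr>"

definition canonical_valuation :: "'p \<Rightarrow> 'w set" where
  "canonical_valuation p = truth_set (Var p)"

lemma canonical_process_simps [simp]:
  "space (events canonical_process) = worlds"
  "sets (events canonical_process) = sigma_sets worlds (range truth_set)"
  "kern canonical_process = canonical_kernel"
  "dyn canonical_process = (\<lambda>x. enc (successor (theory_of x)))"
  using truth_sets_Pow by (simp_all add: canonical_process_def)

lemma truth_set_in_events: "truth_set \<phi> \<in> sigma_sets worlds (range truth_set)"
  by auto

lemma dyn_in_worlds: "x \<in> worlds \<Longrightarrow> enc (successor (theory_of x)) \<in> worlds"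
  using saturated_successor[OF saturated_theory_of] by (auto simp: worlds_def)

lemma dyn_vimage_truth_set:
  "(\<lambda>x. enc (successor (theory_of x))) -` truth_set \<phi> \<inter> worlds = truth_set (Next \<phi>)"
  using dyn_in_worlds by (auto simp: truth_set_def successor_def)

lemma Int_stable_truth_sets: "Int_stable (range truth_set)"
  by (auto simp: Int_stable_def truth_set_Conj[symmetric])

lemma worlds_eq_truth_set: "worlds = truth_set (Neg Bot)"
  by (simp add: truth_set_Neg truth_set_Bot)

lemma mass_measurable: "(\<lambda>x. mass (theory_of x) \<phi>) \<in> borel_measurable (events canonical_process)"
  unfolding borel_measurable_iff_greater
proof
  fix a
  have "a < mass (theory_of x) \<phi> \<longleftrightarrow> (\<exists>r. a < val r \<and> Lop r \<phi> \<in> theory_of x)" if "x \<in> worlds" for x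
    unfolding mass_def less_cSup_iff[OF mass_set(2,1)[OF saturated_theory_of[OF that]]] by auto
  then have "{x \<in> space (events canonical_process). a < mass (theory_of x) \<phi>} =
      (\<Union>r \<in> {r. a < val r}. truth_set (Lop r \<phi>))"
    by (auto simp: truth_set_def)
  also have "\<dots> \<in> sets (events canonical_process)"
    by (intro sets.countable_UN') (auto intro: truth_set_in_events)
  finally show "{x \<in> space (events canonical_process). a < mass (theory_of x) \<phi>}
    \<in> sets (events canonical_process)" .
qed

lemma dynamic_Markov_process_canonical:
  assumes "worlds \<noteq> {}"
  shows "dynamic_Markov_process canonical_process"
  unfolding dynamic_Markov_process_def
proof (intro conjI)
  show "space (events canonical_process) \<noteq> {}" using assms by simp
  show "kern canonical_process \<in>
      events canonical_process \<rightarrow>\<^sub>M prob_algebra (events canonical_process)"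
  proof (rule measurable_prob_algebra_generated[where G = "range truth_set" and \<Omega> = worlds])
    fix x assume "x \<in> space (events canonical_process)"
    then have x: "x \<in> worlds" by simp
    show "prob_space (kern canonical_process x)"
    proof (rule prob_spaceI)
      have "mass (theory_of x) (Neg Bot) = 1"
        by (intro mass_Th saturated_theory_of x Th_taut) (simp add: tautology_def)
      then show "emeasure (kern canonical_process x) (space (kern canonical_process x)) = 1"
        using canonical_kernel(3)[OF x, of "Neg Bot"]
        by (simp add: canonical_kernel(1)[OF x] worlds_eq_truth_set)
    qed
    show "sets (kern canonical_process x) = sets (events canonical_process)"
      using canonical_kernel(2)[OF x] by simp
  next
    fix A assume "A \<in> range truth_set"
    then obtain \<phi> where A: "A = truth_set \<phi>" by blast
    have "(\<lambda>x. ennreal (mass (theory_of x) \<phi>)) \<in> borel_measurable (events canonical_process)"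
      using mass_measurable by (rule measurable_compose) simp
    then show "(\<lambda>x. emeasure (kern canonical_process x) A) \<in> borel_measurable (events canonical_process)"
      by (rule measurable_cong[THEN iffD1, rotated]) (simp add: A canonical_kernel(3))
  qed (use truth_sets_Pow Int_stable_truth_sets in simp_all)
  show "dyn canonical_process \<in> events canonical_process \<rightarrow>\<^sub>M events canonical_process"
    unfolding canonical_process_def process.simps
  proof (rule measurable_measure_of[OF truth_sets_Pow])
    show "(\<lambda>x. enc (successor (theory_of x))) \<in> space (sigma worlds (range truth_set)) \<rightarrow> worlds"
      using dyn_in_worlds truth_sets_Pow by simp
    fix y assume "y \<in> range truth_set"
    then show "(\<lambda>x. enc (successor (theory_of x))) -` y \<inter> space (sigma worlds (range truth_set))
      \<in> sets (sigma worlds (range truth_set))"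
      using dyn_vimage_truth_set truth_sets_Pow truth_set_in_events by auto
  qed
qed

text \<open>The kernel at the successor of \<open>x\<close> and the image under the dynamics of the kernel at \<open>x\<close>
agree on truth sets by axiom M, and truth sets form an intersection-stable generator.\<close>

lemma measure_preserving_canonical:
  assumes "worlds \<noteq> {}"
  shows "measure_preserving canonical_process"
  unfolding measure_preserving_def
proof (intro ballI)
  let ?E = "events canonical_process" and ?f = "dyn canonical_process"
  have f: "?f \<in> ?E \<rightarrow>\<^sub>M ?E"
    using dynamic_Markov_process_canonical[OF assms] by (simp only: dynamic_Markov_process_def)
  fix x A assume "x \<in> space ?E" and A: "A \<in> sets ?E"
  then have x: "x \<in> worlds" by simp
  have fx: "?f x \<in> worlds" using dyn_in_worlds[OF x] by simp
  have sets_x: "sets (canonical_kernel x) = sets ?E" using canonical_kernel(2)[OF x] by simp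
  have fK: "?f \<in> canonical_kernel x \<rightarrow>\<^sub>M ?E"
    using f by (simp only: measurable_cong_sets[OF sets_x refl])
  have "distr (canonical_kernel x) ?E ?f = canonical_kernel (?f x)"
  proof (rule measure_eqI_generator_eq[OF Int_stable_truth_sets truth_sets_Pow, where A = "\<lambda>_. worlds"])
    fix S assume "S \<in> range truth_set"
    then obtain \<phi> where S: "S = truth_set \<phi>" by blast
    have "emeasure (distr (canonical_kernel x) ?E ?f) S = emeasure (canonical_kernel x) (?f -` S \<inter> worlds)"
      using emeasure_distr[OF fK, of S] canonical_kernel(1)[OF x] by (simp add: S)
    also have "\<dots> = ennreal (mass (theory_of x) (Next \<phi>))"
      by (simp add: S dyn_vimage_truth_set canonical_kernel(3)[OF x])
    also have "\<dots> = ennreal (mass (theory_of (?f x)) \<phi>)"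
      by (simp add: mass_successor[OF saturated_theory_of[OF x]])
    also have "\<dots> = emeasure (canonical_kernel (?f x)) S"
      by (simp only: S canonical_kernel(3)[OF fx])
    finally show "emeasure (distr (canonical_kernel x) ?E ?f) S = emeasure (canonical_kernel (?f x)) S" .
  next
    show "range (\<lambda>_. worlds) \<subseteq> range truth_set" using worlds_eq_truth_set by auto
    show "emeasure (distr (canonical_kernel x) ?E ?f) worlds \<noteq> \<infinity>" for i :: nat
    proof -
      have "emeasure (distr (canonical_kernel x) ?E ?f) worlds =
          emeasure (canonical_kernel x) (?f -` worlds \<inter> worlds)"
        using emeasure_distr[OF fK, of worlds] canonical_kernel(1)[OF x] truth_set_in_events
        by (simp add: worlds_eq_truth_set)
      also have "?f -` worlds \<inter> worlds = worlds" using dyn_in_worlds by auto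
      also have "emeasure (canonical_kernel x) worlds \<noteq> \<infinity>"
        unfolding worlds_eq_truth_set canonical_kernel(3)[OF x] by simp
      finally show ?thesis .
    qed
  qed (use canonical_kernel(2)[OF fx] in simp_all)
  then show "measure (kern canonical_process x) (?f -` A \<inter> space ?E) = measure (kern canonical_process (?f x)) A"
    using measure_distr[OF fK A] canonical_kernel(1)[OF x] by simp
qed

lemma valuation_canonical: "valuation canonical_process canonical_valuation"
  by (simp add: valuation_def canonical_valuation_def)

lemma truth_lemma:
  "x \<in> worlds \<Longrightarrow> sat canonical_process canonical_valuation x \<phi> \<longleftrightarrow> \<phi> \<in> theory_of x"
proof (induction \<phi> arbitrary: x)
  case (Var p)
  then show ?case by (simp add: canonical_valuation_def truth_set_def)
next
  case (Neg \<phi>)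
  then show ?case by (simp add: saturated_Neg[OF saturated_theory_of])
next
  case (Conj \<phi> \<psi>)
  then show ?case by (simp add: saturated_Conj[OF saturated_theory_of])
next
  case (Lop r \<phi>)
  have "{u \<in> worlds. sat canonical_process canonical_valuation u \<phi>} = truth_set \<phi>"
    using Lop.IH by (auto simp: truth_set_def)
  then show ?case
    by (simp add: measure_canonical_kernel[OF Lop.prems] mass_ge_iff[OF saturated_theory_of[OF Lop.prems]])
next
  case (Next \<phi>)
  then show ?case using dyn_in_worlds by (simp add: successor_def)
qed

lemma completeness:
  assumes "deductively_closed D" "\<phi> \<notin> D"
  shows "worlds \<noteq> {} \<and> (\<exists>x \<in> worlds. (\<forall>\<psi> \<in> D. sat canonical_process canonical_valuation x \<psi>) \<and>
    \<not> sat canonical_process canonical_valuation x \<phi>)"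
proof -
  obtain u where u: "saturated u" "D \<subseteq> u" "\<phi> \<notin> u" using lindenbaum[OF assms] by blast
  then have "enc u \<in> worlds" by (simp add: worlds_def)
  with u show ?thesis by (auto simp: truth_lemma intro!: bexI[of _ "enc u"])
qed

end

section \<open>Strong completeness\<close>

lemma dpl_logic_theorems:
  assumes "axioms_M \<subseteq> Ax"
  shows "dpl_logic {\<phi> :: 'p::countable fm. is_theorem Ax \<phi>}"
proof
  show "axioms_M \<subseteq> {\<phi> :: 'p fm. is_theorem Ax \<phi>}"
    using assms by (auto simp: is_theorem_iff_derivable intro: derivable.base)
qed (auto simp: is_theorem_iff_derivable intro: derivable.rule)

lemma (in dpl_logic) deductively_closed_derives:
  assumes "Th = {\<phi>. is_theorem Ax \<phi>}"
  shows "deductively_closed {\<phi>. derives Ax \<Gamma> \<phi>}"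
  using derivable.base[of _ "\<Gamma> \<union> Th" basic_rule] derivable.rule[of basic_rule _ _ "\<Gamma> \<union> Th"]
  unfolding deductively_closed_def derives_iff_derivable assms[symmetric] by blast

text \<open>If every \<open>Iff (Next \<psi>) \<psi>\<close> is an axiom, then every saturated set equals its shift,
so the same canonical process serves both systems.\<close>

lemma strong_completeness:
  fixes \<phi> :: "'p::countable fm" and enc :: "'p fm set \<Rightarrow> 'w"
  assumes "axioms_M \<subseteq> Ax" "inj enc" "\<not> derives Ax \<Gamma> \<phi>"
  obtains P :: "'w process" and v x where
    "dynamic_Markov_process P" "measure_preserving P" "valuation P v" "x \<in> space (events P)"
    "\<And>\<gamma>. \<gamma> \<in> \<Gamma> \<Longrightarrow> sat P v x \<gamma>" "\<not> sat P v x \<phi>"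
    "(\<And>\<psi>. Iff (Next \<psi>) \<psi> \<in> Ax) \<Longrightarrow> purely_probabilistic P"
proof -
  interpret dpl_logic "{\<phi> :: 'p fm. is_theorem Ax \<phi>}" using assms(1) by (rule dpl_logic_theorems)
  interpret canonical_model "{\<phi> :: 'p fm. is_theorem Ax \<phi>}" enc by unfold_locales (rule assms(2))
  have "\<phi> \<notin> {\<phi>. derives Ax \<Gamma> \<phi>}" using assms(3) by simp
  from completeness[OF deductively_closed_derives[OF refl] this]
  obtain x where x: "x \<in> worlds" "\<And>\<psi>. derives Ax \<Gamma> \<psi> \<Longrightarrow> sat canonical_process canonical_valuation x \<psi>"
    "\<not> sat canonical_process canonical_valuation x \<phi>" by auto
  then have ne: "worlds \<noteq> {}" by blast
  have \<Gamma>: "derives Ax \<Gamma> \<gamma>" if "\<gamma> \<in> \<Gamma>" for \<gamma>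
    using that by (auto simp: derives_iff_derivable intro: derivable.base)
  have "purely_probabilistic canonical_process" if Ax: "\<And>\<psi>. Iff (Next \<psi>) \<psi> \<in> Ax"
    unfolding purely_probabilistic_def
  proof
    fix y assume "y \<in> space (events canonical_process)"
    then obtain u where u: "saturated u" "y = enc u" by (auto simp: worlds_def)
    have "is_theorem Ax (Iff (Next \<psi>) \<psi>)" for \<psi>
      using Ax by (auto simp: is_theorem_iff_derivable intro: derivable.base)
    then have "Iff (Next \<psi>) \<psi> \<in> u" for \<psi> using saturated_Th[OF u(1)] by simp
    then have "successor u = u" using u(1) by (auto simp: successor_def saturated_Iff)
    with u show "dyn canonical_process y = y" by simp
  qed
  with that[of canonical_process canonical_valuation x] x ne \<Gamma> dynamic_Markov_process_canonical
    measure_preserving_canonical valuation_canonical show thesis by simp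
qed

lemma completeness_M:
  fixes enc :: "'p::countable fm set \<Rightarrow> 'w" and \<phi> :: "'p fm"
  assumes "inj enc" "entails (MP_processes TYPE('w)) \<Gamma> \<phi>"
  shows "derives axioms_M \<Gamma> \<phi>"
proof (rule ccontr)
  assume "\<not> ?thesis"
  from strong_completeness[OF subset_refl assms(1) this] obtain P :: "'w process" and v x where
    "dynamic_Markov_process P" "measure_preserving P" "valuation P v" "x \<in> space (events P)"
    "\<And>\<gamma>. \<gamma> \<in> \<Gamma> \<Longrightarrow> sat P v x \<gamma>" "\<not> sat P v x \<phi>" by metis
  with assms(2) show False by (auto simp: entails_def MP_processes_def)
qed

lemma completeness_Pure:
  fixes enc :: "'p::countable fm set \<Rightarrow> 'w" and \<phi> :: "'p fm"
  assumes "inj enc" "entails (Pure_processes TYPE('w)) \<Gamma> \<phi>"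
  shows "derives axioms_Pure \<Gamma> \<phi>"
proof (rule ccontr)
  assume not: "\<not> ?thesis"
  have "axioms_M \<subseteq> axioms_Pure" and pure: "\<And>\<psi> :: 'p fm. Iff (Next \<psi>) \<psi> \<in> axioms_Pure"
    by (auto simp: axioms_Pure_def)
  from strong_completeness[OF this(1) assms(1) not] pure obtain P :: "'w process" and v x where
    "dynamic_Markov_process P" "purely_probabilistic P" "valuation P v" "x \<in> space (events P)"
    "\<And>\<gamma>. \<gamma> \<in> \<Gamma> \<Longrightarrow> sat P v x \<gamma>" "\<not> sat P v x \<phi>" by metis
  with assms(2) show False by (auto simp: entails_def Pure_processes_def)
qed

theorem theorem2p30:
  assumes "at_least_continuum TYPE('w)"
  shows
    "(\<forall>(\<Gamma> :: 'p::countable fm set) \<phi>.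
        (derives axioms_M \<Gamma> \<phi> \<longleftrightarrow> entails (MP_processes TYPE('w)) \<Gamma> \<phi>) \<and>
        (derives axioms_M \<Gamma> \<phi> \<longrightarrow> entails (MP_processes TYPE('v)) \<Gamma> \<phi>)) \<and>
     (\<forall>(\<Gamma> :: 'p::countable fm set) \<phi>.
        (derives axioms_Pure \<Gamma> \<phi> \<longleftrightarrow> entails (Pure_processes TYPE('w)) \<Gamma> \<phi>) \<and>
        (derives axioms_Pure \<Gamma> \<phi> \<longrightarrow> entails (Pure_processes TYPE('v)) \<Gamma> \<phi>))"
proof -
  obtain e :: "nat set \<Rightarrow> 'w" where "inj e"
    using assms by (auto simp: at_least_continuum_def)
  then have "inj (\<lambda>u :: 'p fm set. e (to_nat ` u))"
    by (intro injI) (simp add: inj_eq inj_image_eq_iff)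
  from completeness_M[OF this] completeness_Pure[OF this] show ?thesis
    by (intro conjI allI iffI impI) (assumption | rule soundness_M soundness_Pure)+
qed

end
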